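(* Let $n\ge2$ and let $\Phi\subset\mathbb{R}^{n+1}$ be a hypersurface of positive Gaussian curvature, with positive definite second fundamental form. For the Pick-invariant $J$ of every relative normalization $\bar y$ of $\Phi$, with support function $q$, the following relation is valid on $M$: $$\frac{J}{q}-\frac{J_{\mathrm{aff}}}{q_{\mathrm{aff}}}\ge 0,$$ where $J_{\mathrm{aff}}$ and $q_{\mathrm{aff}}$ are the Pick-invariant and the support function of the equiaffine normalization $\bar y_{\mathrm{aff}}$ of $\Phi$. The equality holds (identically on $M$) if and only if $\bar y$ and $\bar y_{\mathrm{aff}}$ are constantly proportional.
   Context: Let $n\ge2$. A hypersurface $\Phi=(M,\bar x)$ in $\mathbb{R}^{n+1}$ consists of an oriented connected $n$-dimensional $C^r$-manifold $M$ ($r\ge 3$) and a $C^r$-immersion $\bar x:M\to\mathbb{R}^{n+1}$ whose Gaussian curvature $K_I$ never vanishes. Let $u^1,\dots,u^n$ be local coordinates and write $f_{/i}=\partial f/\partial u^i$, etc. Let $\bar\xi$ be the Euclidean unit normal field, $h_{ij}=\langle\bar\xi,\bar x_{/ij}\rangle$ the components of the second fundamental form $II$, and $K_I=\det(h_{ij})/\det(\langle \bar x_{/i},\bar x_{/j}\rangle)$. A $C^s$-map $\bar y:M\to\mathbb{R}^{n+1}$ ($r>s\ge1$) is a relative normalization of $\Phi$ if at every point of $M$ the vectors $\bar x_{/1},\dots,\bar x_{/n},\bar y$ are linearly independent and every $\bar y_{/i}$ lies in the span of $\bar x_{/1},\dots,\bar x_{/n}$. Here $r,s$ are understood to be large enough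 for all quantities involved to be defined. The support function of $\bar y$ is $q=\langle\bar\xi,\bar y\rangle$; it never vanishes, and orientations are chosen so that $q>0$ (with the same $\bar\xi$ for all relative normalizations being compared). The covector $\bar X$ is defined by $\langle\bar X,\bar x_{/i}\rangle=0$ for all $i$ and $\langle\bar X,\bar y\rangle=1$, so $\bar X=q^{-1}\bar\xi$. The relative metric is the metric $G_{ij}=\langle\bar X,\bar x_{/ij}\rangle=q^{-1}h_{ij}$; indices are raised and lowered with $G$, and $\nabla^G$ is its Levi-Civita covariant derivative. The Darboux tensor is $A_{jkl}=\langle\bar X,\nabla^G_l\nabla^G_k\bar x_{/j}\rangle$, and the Pick-invariant is $J=\frac1{n(n-1)}A_{jkl}A^{jkl}$. The equiaffine normalization $\bar y_{\mathrm{aff}}$ is the (unique) relative normalization with support function $q_{\mathrm{aff}}=|K_I|^{1/(n+2)}$; the subscript "aff" denotes quantities formed for $\bar y_{\mathrm{aff}}$. The normalizations $\bar y$ and $\bar y_{\mathrm{aff}}$ are called constantly proportional if $q=c\,q_{\mathrm{aff}}$ for a constant $c\in\mathbb{R}\setminus\{0\}$ (equivalently $\bar y=c\,\bar y_{\mathrm{aff}}$). *)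

theory Defs
  imports "HOL-Analysis.Analysis"
begin

section \<open>Functions of class \<open>C\<^sup>k\<close> and partial derivatives\<close>

text \<open>To be used on open sets only.\<close>

fun Ck_on :: "nat \<Rightarrow> ('a::real_normed_vector \<Rightarrow> 'b::real_normed_vector) \<Rightarrow> 'a set \<Rightarrow> bool" where
  "Ck_on 0 f S \<longleftrightarrow> continuous_on S f"
| "Ck_on (Suc k) f S \<longleftrightarrow>
     (\<forall>u\<in>S. f differentiable (at u)) \<and>
     (\<forall>v. Ck_on k (\<lambda>u. frechet_derivative f (at u) v) S)"

definition partial :: "'n \<Rightarrow> (real^'n \<Rightarrow> 'b::real_normed_vector) \<Rightarrow> real^'n \<Rightarrow> 'b" where
  "partial i f u = frechet_derivative f (at u) (axis i 1)"


section \<open>Oriented manifolds\<close>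

text \<open>A chart is its domain together with its coordinate map; only the values of the coordinate
  map on the domain matter.\<close>

type_synonym ('p, 'n) chart = "'p set \<times> ('p \<Rightarrow> real^'n)"

abbreviation chart_dom :: "('p, 'n) chart \<Rightarrow> 'p set" where
  "chart_dom c \<equiv> fst c"

abbreviation chart_img :: "('p, 'n) chart \<Rightarrow> (real^'n) set" where
  "chart_img c \<equiv> snd c ` fst c"

definition in_chart :: "('p, 'n) chart \<Rightarrow> ('p \<Rightarrow> 'b) \<Rightarrow> real^'n \<Rightarrow> 'b" where
  "in_chart c f = f \<circ> inv_into (fst c) (snd c)"

definition is_chart :: "'p topology \<Rightarrow> ('p, 'n::finite) chart \<Rightarrow> bool" where
  "is_chart T c \<longleftrightarrow> openin T (chart_dom c) \<and> open (chart_img c) \<and>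
     homeomorphic_map (subtopology T (chart_dom c)) (top_of_set (chart_img c)) (snd c)"

definition oriented_atlas :: "nat \<Rightarrow> 'p topology \<Rightarrow> ('p, 'n::finite) chart set \<Rightarrow> bool" where
  "oriented_atlas r T A \<longleftrightarrow>
     (\<forall>c\<in>A. is_chart T c) \<and> (\<Union>c\<in>A. chart_dom c) = topspace T \<and>
     (\<forall>c\<in>A. \<forall>d\<in>A.
        let \<tau> = in_chart c (snd d); W = snd c ` (chart_dom c \<inter> chart_dom d) in
        Ck_on r \<tau> W \<and> (\<forall>u\<in>W. det (matrix (frechet_derivative \<tau> (at u))) > 0))"

definition connected_oriented_manifold ::
  "nat \<Rightarrow> 'p topology \<Rightarrow> ('p, 'n::finite) chart set \<Rightarrow> bool" where
  "connected_oriented_manifold r T A \<longleftrightarrow>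
     Hausdorff_space T \<and> second_countable T \<and> connected_space T \<and> oriented_atlas r T A"

definition Ck_map ::
  "nat \<Rightarrow> ('p, 'n::finite) chart set \<Rightarrow> ('p \<Rightarrow> 'b::real_normed_vector) \<Rightarrow> bool" where
  "Ck_map k A f \<longleftrightarrow> (\<forall>c\<in>A. Ck_on k (in_chart c f) (chart_img c))"

text \<open>Some chart of the atlas around \<open>p\<close>. It is used to turn coordinate expressions that do not
  depend on the coordinates (Gaussian curvature, Pick-invariant) into functions on the manifold.\<close>

definition chart_at :: "('p, 'n) chart set \<Rightarrow> 'p \<Rightarrow> ('p, 'n) chart" where
  "chart_at A p = (SOME c. c \<in> A \<and> p \<in> chart_dom c)"


section \<open>Local expressions\<close>

text \<open>In this section \<open>f\<close>, \<open>N\<close>, \<open>y\<close> are the coordinate expressions of the immersion, of a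
  (co)vector field along it, and of a relative normalization.\<close>

definition first_form :: "(real^'n \<Rightarrow> real^'m) \<Rightarrow> real^'n \<Rightarrow> real^'n^'n" where
  "first_form f u = (\<chi> i j. partial i f u \<bullet> partial j f u)"

definition second_form ::
  "(real^'n \<Rightarrow> real^'m) \<Rightarrow> (real^'n \<Rightarrow> real^'m) \<Rightarrow> real^'n \<Rightarrow> real^'n^'n" where
  "second_form N f u = (\<chi> i j. N u \<bullet> partial j (partial i f) u)"

definition local_gauss_curvature ::
  "(real^'n \<Rightarrow> real^'m) \<Rightarrow> (real^'n \<Rightarrow> real^'m) \<Rightarrow> real^'n \<Rightarrow> real" where
  "local_gauss_curvature \<xi> f u = det (second_form \<xi> f u) / det (first_form f u)"

definition covector ::
  "(real^'n \<Rightarrow> real^'m) \<Rightarrow> (real^'n \<Rightarrow> real^'m) \<Rightarrow> real^'n \<Rightarrow> real^'m" where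
  "covector f y u = (THE X. (\<forall>i. X \<bullet> partial i f u = 0) \<and> X \<bullet> y u = 1)"

definition relative_metric ::
  "(real^'n \<Rightarrow> real^'m) \<Rightarrow> (real^'n \<Rightarrow> real^'m) \<Rightarrow> real^'n \<Rightarrow> real^'n^'n" where
  "relative_metric f y = second_form (covector f y) f"

text \<open>Christoffel symbol \<open>\<Gamma>\<close> of \<open>G\<close> with upper index \<open>m\<close> and lower indices \<open>j\<close>, \<open>k\<close>.\<close>

definition christoffel ::
  "(real^'n \<Rightarrow> real^'n^'n) \<Rightarrow> 'n \<Rightarrow> 'n \<Rightarrow> 'n \<Rightarrow> real^'n \<Rightarrow> real" where
  "christoffel G m j k u =
     (\<Sum>l\<in>UNIV. matrix_inv (G u) $ m $ l *
        (partial j (\<lambda>v. G v $ k $ l) u + partial k (\<lambda>v. G v $ j $ l) u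
          - partial l (\<lambda>v. G v $ j $ k) u)) / 2"

text \<open>Levi-Civita covariant derivatives \<open>\<nabla>\<^sub>k T\<^sub>j\<close> and \<open>\<nabla>\<^sub>l T\<^sub>j\<^sub>k\<close> of covariant tensors of order one
  and two. The components may be vector-valued: the components in the ambient space are
  treated as scalars.\<close>

definition cov_deriv1 ::
  "(real^'n \<Rightarrow> real^'n^'n) \<Rightarrow> ('n \<Rightarrow> real^'n \<Rightarrow> 'b::real_normed_vector) \<Rightarrow>
     'n \<Rightarrow> 'n \<Rightarrow> real^'n \<Rightarrow> 'b" where
  "cov_deriv1 G T k j u =
     partial k (T j) u - (\<Sum>m\<in>UNIV. christoffel G m k j u *\<^sub>R T m u)"

definition cov_deriv2 ::
  "(real^'n \<Rightarrow> real^'n^'n) \<Rightarrow> ('n \<Rightarrow> 'n \<Rightarrow> real^'n \<Rightarrow> 'b::real_normed_vector) \<Rightarrow>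
     'n \<Rightarrow> 'n \<Rightarrow> 'n \<Rightarrow> real^'n \<Rightarrow> 'b" where
  "cov_deriv2 G T l j k u =
     partial l (T j k) u - (\<Sum>m\<in>UNIV. christoffel G m l j u *\<^sub>R T m k u)
       - (\<Sum>m\<in>UNIV. christoffel G m l k u *\<^sub>R T j m u)"

text \<open>\<open>A\<^sub>j\<^sub>k\<^sub>l = \<langle>X, \<nabla>\<^sub>l \<nabla>\<^sub>k f\<^sub>/\<^sub>j\<rangle>\<close>\<close>

definition darboux ::
  "(real^'n \<Rightarrow> real^'m) \<Rightarrow> (real^'n \<Rightarrow> real^'m) \<Rightarrow> 'n \<Rightarrow> 'n \<Rightarrow> 'n \<Rightarrow> real^'n \<Rightarrow> real" where
  "darboux f y j k l u =
     (let G = relative_metric f y in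
      covector f y u \<bullet>
        cov_deriv2 G (\<lambda>j k. cov_deriv1 G (\<lambda>i. partial i f) k j) l j k u)"

definition darboux_up ::
  "(real^'n \<Rightarrow> real^'m) \<Rightarrow> (real^'n \<Rightarrow> real^'m) \<Rightarrow> 'n \<Rightarrow> 'n \<Rightarrow> 'n \<Rightarrow> real^'n \<Rightarrow> real" where
  "darboux_up f y j k l u =
     (let H = matrix_inv (relative_metric f y u) in
      \<Sum>a\<in>UNIV. \<Sum>b\<in>UNIV. \<Sum>c\<in>UNIV. H $ j $ a * H $ k $ b * H $ l $ c * darboux f y a b c u)"

definition local_pick :: "(real^'n \<Rightarrow> real^'m) \<Rightarrow> (real^'n \<Rightarrow> real^'m) \<Rightarrow> real^'n \<Rightarrow> real" where
  "local_pick f y u =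
     (\<Sum>j\<in>UNIV. \<Sum>k\<in>UNIV. \<Sum>l\<in>UNIV. darboux f y j k l u * darboux_up f y j k l u)
       / (real CARD('n) * (real CARD('n) - 1))"


section \<open>Hypersurfaces and relative normalizations\<close>

definition immersion ::
  "nat \<Rightarrow> ('p, 'n::finite) chart set \<Rightarrow> ('p \<Rightarrow> real^'m) \<Rightarrow> bool" where
  "immersion r A x \<longleftrightarrow> Ck_map r A x \<and>
     (\<forall>c\<in>A. \<forall>u\<in>chart_img c. inj (frechet_derivative (in_chart c x) (at u)))"

text \<open>For \<open>CARD('m) = CARD('n) + 1\<close> and connected \<open>T\<close> there are two unit normal fields; choosing
  one of them amounts to choosing the orientation.\<close>

definition unit_normal_field ::
  "'p topology \<Rightarrow> ('p, 'n::finite) chart set \<Rightarrow> ('p \<Rightarrow> real^'m) \<Rightarrow> ('p \<Rightarrow> real^'m) \<Rightarrow> bool" where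
  "unit_normal_field T A x \<xi> \<longleftrightarrow> continuous_map T euclidean \<xi> \<and>
     (\<forall>p\<in>topspace T. norm (\<xi> p) = 1) \<and>
     (\<forall>c\<in>A. \<forall>u\<in>chart_img c. \<forall>i. in_chart c \<xi> u \<bullet> partial i (in_chart c x) u = 0)"

definition gauss_curvature ::
  "('p, 'n::finite) chart set \<Rightarrow> ('p \<Rightarrow> real^'m) \<Rightarrow> ('p \<Rightarrow> real^'m) \<Rightarrow> 'p \<Rightarrow> real" where
  "gauss_curvature A x \<xi> p =
     (let c = chart_at A p in local_gauss_curvature (in_chart c \<xi>) (in_chart c x) (snd c p))"

definition hypersurface ::
  "nat \<Rightarrow> 'p topology \<Rightarrow> ('p, 'n::finite) chart set \<Rightarrow> ('p \<Rightarrow> real^'m) \<Rightarrow> ('p \<Rightarrow> real^'m) \<Rightarrow> bool"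
  where
  "hypersurface r T A x \<xi> \<longleftrightarrow>
     CARD('m) = CARD('n) + 1 \<and> connected_oriented_manifold r T A \<and>
     immersion r A x \<and> unit_normal_field T A x \<xi> \<and>
     (\<forall>p\<in>topspace T. gauss_curvature A x \<xi> p \<noteq> 0)"

definition positive_definite_II ::
  "('p, 'n::finite) chart set \<Rightarrow> ('p \<Rightarrow> real^'m) \<Rightarrow> ('p \<Rightarrow> real^'m) \<Rightarrow> bool" where
  "positive_definite_II A x \<xi> \<longleftrightarrow>
     (\<forall>c\<in>A. \<forall>u\<in>chart_img c. \<forall>v. v \<noteq> 0 \<longrightarrow>
        v \<bullet> (second_form (in_chart c \<xi>) (in_chart c x) u *v v) > 0)"

definition relative_normalization ::
  "nat \<Rightarrow> ('p, 'n::finite) chart set \<Rightarrow> ('p \<Rightarrow> real^'m) \<Rightarrow> ('p \<Rightarrow> real^'m) \<Rightarrow> bool" where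
  "relative_normalization s A x y \<longleftrightarrow> Ck_map s A y \<and>
     (\<forall>c\<in>A. \<forall>u\<in>chart_img c.
        let f = in_chart c x; g = in_chart c y in
        (\<forall>a b. (\<Sum>i\<in>UNIV. a i *\<^sub>R partial i f u) + b *\<^sub>R g u = 0 \<longrightarrow> (\<forall>i. a i = 0) \<and> b = 0) \<and>
        (\<forall>i. partial i g u \<in> span (range (\<lambda>j. partial j f u))))"

definition support :: "('p \<Rightarrow> real^'m) \<Rightarrow> ('p \<Rightarrow> real^'m) \<Rightarrow> 'p \<Rightarrow> real" where
  "support \<xi> y p = \<xi> p \<bullet> y p"

definition pick_invariant ::
  "('p, 'n::finite) chart set \<Rightarrow> ('p \<Rightarrow> real^'m) \<Rightarrow> ('p \<Rightarrow> real^'m) \<Rightarrow> 'p \<Rightarrow> real" where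
  "pick_invariant A x y p =
     (let c = chart_at A p in local_pick (in_chart c x) (in_chart c y) (snd c p))"

text \<open>These conditions determine \<open>y\<close> uniquely on \<open>T\<close>. Its differentiability class may be
  lower than that of other relative normalizations, hence only \<open>C\<^sup>1\<close> is required.\<close>

definition equiaffine_normalization ::
  "'p topology \<Rightarrow> ('p, 'n::finite) chart set \<Rightarrow> ('p \<Rightarrow> real^'m) \<Rightarrow> ('p \<Rightarrow> real^'m) \<Rightarrow>
     ('p \<Rightarrow> real^'m) \<Rightarrow> bool" where
  "equiaffine_normalization T A x \<xi> y \<longleftrightarrow> relative_normalization 1 A x y \<and>
     (\<forall>p\<in>topspace T.
        support \<xi> y p = \<bar>gauss_curvature A x \<xi> p\<bar> powr (1 / (real CARD('n) + 2)))"

definition constantly_proportional ::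
  "'p topology \<Rightarrow> ('p \<Rightarrow> real^'m) \<Rightarrow> ('p \<Rightarrow> real^'m) \<Rightarrow> ('p \<Rightarrow> real^'m) \<Rightarrow> bool" where
  "constantly_proportional T \<xi> y y' \<longleftrightarrow>
     (\<exists>c. c \<noteq> 0 \<and> (\<forall>p\<in>topspace T. support \<xi> y p = c * support \<xi> y' p))"

end

theory Submission
  imports Defs
begin

text \<open>Everything is expressed through the covector \<open>X\<close>, which solves a linear system and is therefore
  twice differentiable although \<open>y\<close> may be only \<open>C\<^sup>1\<close>. The Darboux tensor is
  \<open>A\<^sub>j\<^sub>k\<^sub>l = \<langle>X, f\<^sub>/\<^sub>j\<^sub>k\<^sub>l\<rangle> - (\<partial>\<^sub>j G\<^sub>k\<^sub>l + \<partial>\<^sub>k G\<^sub>j\<^sub>l + \<partial>\<^sub>l G\<^sub>j\<^sub>k) / 2\<close>. If \<open>X = \<rho> X\<^sub>a\<^sub>f\<^sub>f\<close>, that is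
  \<open>\<rho> = q\<^sub>a\<^sub>f\<^sub>f / q\<close>, then \<open>A = \<rho> (A\<^sub>a\<^sub>f\<^sub>f + S)\<close> where \<open>S\<close> is the symmetric product of \<open>- d\<rho> / (2 \<rho>)\<close> with
  \<open>G\<^sub>a\<^sub>f\<^sub>f\<close>. Since \<open>A\<^sub>a\<^sub>f\<^sub>f\<close> is trace-free, it is orthogonal to \<open>S\<close>, so \<open>J/q - J\<^sub>a\<^sub>f\<^sub>f/q\<^sub>a\<^sub>f\<^sub>f\<close> is a positive
  multiple of the squared length of \<open>d\<rho>\<close>.\<close>

section \<open>Partial derivatives\<close>

lemma partial_eqI: "(f has_derivative D) (at u) \<Longrightarrow> partial i f u = D (axis i 1)"
  by (simp add: partial_def flip: frechet_derivative_at)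

lemma has_frechet_derivative:
  "f differentiable (at u) \<Longrightarrow> (f has_derivative frechet_derivative f (at u)) (at u)"
  by (simp flip: frechet_derivative_works)

lemma partial_transform:
  assumes "open S" "u \<in> S" "f differentiable (at u)" "\<And>v. v \<in> S \<Longrightarrow> f v = g v"
  shows "partial i g u = partial i f u"
  unfolding partial_def
  using frechet_derivative_transform_within_open[of f u S g] assms by simp

lemma differentiable_transform_open:
  assumes "open S" "u \<in> S" "f differentiable (at u)" "\<And>v. v \<in> S \<Longrightarrow> f v = g v"
  shows "g differentiable (at u)"
  using assms has_derivative_transform_within_open unfolding differentiable_def by metis

lemma partial_const [simp]: "partial i (\<lambda>v. c) u = 0"
  by (simp add: partial_def)

lemma partial_diff:
  assumes "f differentiable (at u)" "g differentiable (at u)"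
  shows "partial i (\<lambda>v. f v - g v) u = partial i f u - partial i g u"
  using partial_eqI[OF has_derivative_diff[OF has_frechet_derivative has_frechet_derivative]] assms
  by (simp add: partial_def)

lemma partial_sum:
  assumes "\<And>a. a \<in> I \<Longrightarrow> f a differentiable (at u)"
  shows "partial i (\<lambda>v. \<Sum>a\<in>I. f a v) u = (\<Sum>a\<in>I. partial i (f a) u)"
  unfolding partial_def[of i "f _"]
  by (rule partial_eqI) (intro has_derivative_sum has_frechet_derivative assms)

lemma partial_scaleR:
  assumes "f differentiable (at u)" "g differentiable (at u)"
  shows "partial i (\<lambda>v. f v *\<^sub>R g v) u = f u *\<^sub>R partial i g u + partial i f u *\<^sub>R g u"
  using partial_eqI[OF has_derivative_scaleR[OF has_frechet_derivative has_frechet_derivative]] assms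
  by (simp add: partial_def)

lemma partial_mult:
  fixes f g :: "real^'n \<Rightarrow> real"
  assumes "f differentiable (at u)" "g differentiable (at u)"
  shows "partial i (\<lambda>v. f v * g v) u = f u * partial i g u + partial i f u * g u"
  using partial_scaleR[OF assms] by simp

lemma partial_inner:
  fixes f g :: "real^'n \<Rightarrow> 'b::real_inner"
  assumes "f differentiable (at u)" "g differentiable (at u)"
  shows "partial i (\<lambda>v. f v \<bullet> g v) u = f u \<bullet> partial i g u + partial i f u \<bullet> g u"
  using partial_eqI[OF has_derivative_inner[OF has_frechet_derivative has_frechet_derivative]] assms
  by (simp add: partial_def)

lemma frechet_derivative_eq_sum_partial:
  fixes f :: "real^'n::finite \<Rightarrow> 'b::real_normed_vector"
  assumes "f differentiable (at u)"
  shows "frechet_derivative f (at u) w = (\<Sum>i\<in>UNIV. (w $ i) *\<^sub>R partial i f u)"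
proof -
  interpret linear "frechet_derivative f (at u)"
    using assms by (rule linear_frechet_derivative)
  have "w = (\<Sum>i\<in>UNIV. (w $ i) *\<^sub>R axis i 1)"
    by (metis (no_types, lifting) basis_expansion scalar_mult_eq_scaleR sum.cong)
  then show ?thesis
    unfolding partial_def by (metis (no_types, lifting) scale sum sum.cong)
qed

lemma partial_compose:
  fixes \<tau> :: "real^'n::finite \<Rightarrow> real^'k::finite" and f :: "real^'k \<Rightarrow> 'b::real_normed_vector"
  assumes "\<tau> differentiable (at u)" "f differentiable (at (\<tau> u))"
  shows "partial i (\<lambda>v. f (\<tau> v)) u = (\<Sum>a\<in>UNIV. (partial i \<tau> u $ a) *\<^sub>R partial a f (\<tau> u))"
proof -
  have "partial i (\<lambda>v. f (\<tau> v)) u = frechet_derivative f (at (\<tau> u)) (partial i \<tau> u)"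
    using frechet_derivative_compose[OF assms] by (simp add: partial_def o_def)
  then show ?thesis by (simp only: frechet_derivative_eq_sum_partial[OF assms(2)])
qed

lemma second_difference_mvt:
  fixes f :: "real^'n::finite \<Rightarrow> real"
  assumes S: "\<And>s t. 0 \<le> s \<Longrightarrow> s \<le> h \<Longrightarrow> 0 \<le> t \<Longrightarrow> t \<le> h \<Longrightarrow> u + s *\<^sub>R axis i 1 + t *\<^sub>R axis j 1 \<in> S"
    and h: "h > 0"
    and f: "\<And>v. v \<in> S \<Longrightarrow> f differentiable (at v)"
    and fi: "\<And>v. v \<in> S \<Longrightarrow> partial i f differentiable (at v)"
  shows "\<exists>s\<in>{0<..<h}. \<exists>t\<in>{0<..<h}.
    f (u + h *\<^sub>R axis i 1 + h *\<^sub>R axis j 1) - f (u + h *\<^sub>R axis i 1) - f (u + h *\<^sub>R axis j 1) + f u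
      = h * (h * partial j (partial i f) (u + s *\<^sub>R axis i 1 + t *\<^sub>R axis j 1))"
proof -
  define a b :: "real^'n" where "a = axis i 1" and "b = axis j 1"
  have shift: "((\<lambda>s. g (p + s *\<^sub>R e)) has_derivative (\<lambda>r. r *\<^sub>R frechet_derivative g (at (p + s *\<^sub>R e)) e)) (at s)"
    if "g differentiable (at (p + s *\<^sub>R e))" for g :: "real^'n \<Rightarrow> real" and p e s
  proof -
    interpret linear "frechet_derivative g (at (p + s *\<^sub>R e))"
      using that by (rule linear_frechet_derivative)
    have "((\<lambda>s. p + s *\<^sub>R e) has_derivative (\<lambda>r. r *\<^sub>R e)) (at s)"
      by (auto intro!: derivative_eq_intros)
    from has_derivative_compose[OF this has_frechet_derivative[OF that]]
    show ?thesis by (simp add: scale)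
  qed
  have inS: "u + s *\<^sub>R a + t *\<^sub>R b \<in> S" if "0 \<le> s" "s \<le> h" "0 \<le> t" "t \<le> h" for s t
    using S that by (simp add: a_def b_def)
  have der: "((\<lambda>s. f ((u + h *\<^sub>R b) + s *\<^sub>R a) - f (u + s *\<^sub>R a)) has_derivative
      (\<lambda>r. r *\<^sub>R partial i f ((u + h *\<^sub>R b) + s *\<^sub>R a) - r *\<^sub>R partial i f (u + s *\<^sub>R a))) (at s)"
    if "0 \<le> s" "s \<le> h" for s
    unfolding partial_def a_def
    by (intro has_derivative_diff shift f)
      (use inS[of s h] inS[of s 0] that h in \<open>auto simp: algebra_simps a_def b_def\<close>)
  have "\<exists>s\<in>{0<..<h}. (f ((u + h *\<^sub>R b) + h *\<^sub>R a) - f (u + h *\<^sub>R a)) -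
       (f ((u + h *\<^sub>R b) + 0 *\<^sub>R a) - f (u + 0 *\<^sub>R a)) =
       (h - 0) *\<^sub>R partial i f ((u + h *\<^sub>R b) + s *\<^sub>R a) - (h - 0) *\<^sub>R partial i f (u + s *\<^sub>R a)"
    by (rule mvt_simple[OF h], rule has_derivative_at_withinI, rule der)
  then obtain s where s: "s \<in> {0<..<h}" and
    eq: "f (u + h *\<^sub>R a + h *\<^sub>R b) - f (u + h *\<^sub>R a) - f (u + h *\<^sub>R b) + f u
      = h * (partial i f ((u + s *\<^sub>R a) + h *\<^sub>R b) - partial i f (u + s *\<^sub>R a))"
    by (auto simp: algebra_simps)
  have "\<exists>t\<in>{0<..<h}. partial i f ((u + s *\<^sub>R a) + h *\<^sub>R b) - partial i f ((u + s *\<^sub>R a) + 0 *\<^sub>R b)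
      = (h - 0) *\<^sub>R partial j (partial i f) ((u + s *\<^sub>R a) + t *\<^sub>R b)"
    unfolding partial_def[of j] b_def
    by (rule mvt_simple[OF h], rule has_derivative_at_withinI, rule shift, rule fi)
      (use inS[of s] s in \<open>auto simp: b_def\<close>)
  then obtain t where t: "t \<in> {0<..<h}" and
    "partial i f ((u + s *\<^sub>R a) + h *\<^sub>R b) - partial i f (u + s *\<^sub>R a)
      = h * partial j (partial i f) ((u + s *\<^sub>R a) + t *\<^sub>R b)" by auto
  with eq s t show ?thesis unfolding a_def b_def by metis
qed

lemma partial_commute_real:
  fixes f :: "real^'n::finite \<Rightarrow> real"
  assumes S: "open S" "u \<in> S"
    and f: "\<And>v. v \<in> S \<Longrightarrow> f differentiable (at v)"
    and fi: "\<And>i v. v \<in> S \<Longrightarrow> partial i f differentiable (at v)"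
    and cont: "\<And>i j. continuous (at u) (partial j (partial i f))"
  shows "partial i (partial j f) u = partial j (partial i f) u"
proof -
  have "\<bar>partial i (partial j f) u - partial j (partial i f) u\<bar> \<le> e" if "e > 0" for e
  proof -
    have "\<exists>d>0. \<forall>v. dist v u < d \<longrightarrow> dist (partial j (partial i f) v) (partial j (partial i f) u) < e/2" for i j
      using cont[of j i] \<open>e > 0\<close> unfolding continuous_at_eps_delta by (metis half_gt_zero)
    then obtain d1 d2 where d: "d1 > 0" "d2 > 0"
      "\<And>v. dist v u < d1 \<Longrightarrow> dist (partial j (partial i f) v) (partial j (partial i f) u) < e/2"
      "\<And>v. dist v u < d2 \<Longrightarrow> dist (partial i (partial j f) v) (partial i (partial j f) u) < e/2"
      by metis
    obtain d0 where d0: "d0 > 0" "ball u d0 \<subseteq> S"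
      using S open_contains_ball by blast
    define h where "h = min d0 (min d1 d2) / 3"
    have h: "h > 0" using d d0 by (simp add: h_def)
    have near: "dist (u + s *\<^sub>R axis i 1 + t *\<^sub>R axis j 1) u < min d0 (min d1 d2)"
      if "0 \<le> s" "s \<le> h" "0 \<le> t" "t \<le> h" for s t i j
    proof -
      have "dist (u + s *\<^sub>R axis i 1 + t *\<^sub>R axis j 1) u = norm (s *\<^sub>R axis i 1 + t *\<^sub>R axis j 1 :: real^'n)"
        by (simp add: dist_norm)
      also have "\<dots> \<le> s + t"
        using norm_triangle_ineq[of "s *\<^sub>R axis i (1::real)" "t *\<^sub>R axis j 1"] that by simp
      also have "\<dots> < 3 * h" using that h by simp
      finally show ?thesis by (simp add: h_def)
    qed
    have inS: "u + s *\<^sub>R axis i 1 + t *\<^sub>R axis j 1 \<in> S"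
      if "0 \<le> s" "s \<le> h" "0 \<le> t" "t \<le> h" for s t i j
      using near[OF that, of i j] d0 by (auto simp: dist_commute)
    obtain s t where st: "s \<in> {0<..<h}" "t \<in> {0<..<h}"
      "f (u + h *\<^sub>R axis i 1 + h *\<^sub>R axis j 1) - f (u + h *\<^sub>R axis i 1) - f (u + h *\<^sub>R axis j 1) + f u
        = h * (h * partial j (partial i f) (u + s *\<^sub>R axis i 1 + t *\<^sub>R axis j 1))"
      using second_difference_mvt[of h u i j S f, OF inS h f fi] by blast
    obtain s' t' where st': "s' \<in> {0<..<h}" "t' \<in> {0<..<h}"
      "f (u + h *\<^sub>R axis j 1 + h *\<^sub>R axis i 1) - f (u + h *\<^sub>R axis j 1) - f (u + h *\<^sub>R axis i 1) + f u
        = h * (h * partial i (partial j f) (u + s' *\<^sub>R axis j 1 + t' *\<^sub>R axis i 1))"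
      using second_difference_mvt[of h u j i S f, OF inS h f fi] by blast
    have "h * (h * partial j (partial i f) (u + s *\<^sub>R axis i 1 + t *\<^sub>R axis j 1))
      = h * (h * partial i (partial j f) (u + s' *\<^sub>R axis j 1 + t' *\<^sub>R axis i 1))"
      using st(3) st'(3) by (simp add: algebra_simps)
    then have eq: "partial j (partial i f) (u + s *\<^sub>R axis i 1 + t *\<^sub>R axis j 1)
      = partial i (partial j f) (u + s' *\<^sub>R axis j 1 + t' *\<^sub>R axis i 1)"
      using h by simp
    have "dist (partial j (partial i f) (u + s *\<^sub>R axis i 1 + t *\<^sub>R axis j 1)) (partial j (partial i f) u) < e/2"
      using near[of s t i j] st d(3) by auto
    moreover have "dist (partial j (partial i f) (u + s *\<^sub>R axis i 1 + t *\<^sub>R axis j 1)) (partial i (partial j f) u) < e/2"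
      unfolding eq using near[of s' t' j i] st' d(4) by auto
    ultimately have "dist (partial i (partial j f) u) (partial j (partial i f) u) < e"
      by (rule dist_triangle_half_r[rotated])
    then show ?thesis by (simp add: dist_real_def)
  qed
  then have "\<bar>partial i (partial j f) u - partial j (partial i f) u\<bar> \<le> 0"
    by (rule field_le_epsilon) simp
  then show ?thesis by simp
qed

lemma partial_commute:
  fixes f :: "real^'n::finite \<Rightarrow> 'b::real_inner"
  assumes S: "open S" "u \<in> S"
    and f: "\<And>v. v \<in> S \<Longrightarrow> f differentiable (at v)"
    and fi: "\<And>i v. v \<in> S \<Longrightarrow> partial i f differentiable (at v)"
    and fij: "\<And>i j. partial j (partial i f) differentiable (at u)"
  shows "partial i (partial j f) u = partial j (partial i f) u"
proof -
  have "partial i (partial j f) u \<bullet> c = partial j (partial i f) u \<bullet> c" for c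
  proof -
    let ?g = "\<lambda>v. f v \<bullet> c"
    have d0: "?g differentiable (at v)" if "v \<in> S" for v
      using f[OF that] by simp
    have p1: "partial i ?g v = partial i f v \<bullet> c" if "v \<in> S" for v i
      using f[OF that] by (simp add: partial_inner)
    have d1': "(\<lambda>v. partial i f v \<bullet> c) differentiable (at v)" if "v \<in> S" for v i
      using fi[OF that] by simp
    have d1: "partial i ?g differentiable (at v)" if "v \<in> S" for v i
      by (rule differentiable_transform_open[OF S(1) that d1'[OF that]]) (simp add: p1)
    have p2: "partial j (partial i ?g) v = partial j (partial i f) v \<bullet> c" if "v \<in> S" for v i j
      using partial_transform[OF S(1) that d1'[OF that], where g = "partial i ?g"] p1 fi[OF that]
      by (simp add: partial_inner)
    have "(\<lambda>v. partial j (partial i f) v \<bullet> c) differentiable (at u)" for i j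
      using fij by simp
    then have "partial j (partial i ?g) differentiable (at u)" for i j
      by (rule differentiable_transform_open[OF S]) (simp add: p2)
    then have "partial i (partial j ?g) u = partial j (partial i ?g) u"
      using partial_commute_real[OF S d0 d1] differentiable_imp_continuous_within by blast
    then show ?thesis using S p2 by simp
  qed
  then show ?thesis using inner_commute vector_eq_ldot by metis
qed

section \<open>Determinants and inverse matrices\<close>

lemma matrix_inv_inverse:
  fixes M :: "real^'n^'n"
  assumes "det M \<noteq> 0"
  shows "M ** matrix_inv M = mat 1" "matrix_inv M ** M = mat 1"
proof -
  have "\<exists>B. M ** B = mat 1 \<and> B ** M = mat 1"
    using assms unfolding invertible_det_nz[symmetric] invertible_def .
  then have "M ** matrix_inv M = mat 1 \<and> matrix_inv M ** M = mat 1"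
    unfolding matrix_inv_def by (rule someI_ex)
  then show "M ** matrix_inv M = mat 1" "matrix_inv M ** M = mat 1" by auto
qed

lemma sum_matrix_inv:
  fixes M :: "real^'n^'n"
  assumes "det M \<noteq> 0"
  shows "(\<Sum>k\<in>UNIV. M $ i $ k * matrix_inv M $ k $ j) = (if i = j then 1 else 0)"
    and "(\<Sum>k\<in>UNIV. matrix_inv M $ i $ k * M $ k $ j) = (if i = j then 1 else 0)"
  using matrix_inv_inverse[OF assms] by (auto simp: matrix_matrix_mult_def mat_def vec_eq_iff)

lemma matrix_inv_unique:
  fixes M :: "real^'n^'n"
  assumes "B ** M = mat 1"
  shows "matrix_inv M = B"
proof -
  have "M ** B = mat 1" using assms matrix_left_right_inverse by blast
  then have "det M \<noteq> 0" using assms unfolding invertible_det_nz[symmetric] invertible_def by blast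
  then have "B ** (M ** matrix_inv M) = B" by (simp add: matrix_inv_inverse)
  then show ?thesis using assms by (simp add: matrix_mul_assoc)
qed

lemma matrix_inv_symmetric:
  fixes M :: "real^'n^'n"
  assumes "det M \<noteq> 0" "\<And>i j. M $ i $ j = M $ j $ i"
  shows "matrix_inv M $ i $ j = matrix_inv M $ j $ i"
proof -
  have "transpose M = M" using assms(2) by (simp add: transpose_def vec_eq_iff)
  then have "transpose (matrix_inv M) ** M = transpose (M ** matrix_inv M)"
    by (simp add: matrix_transpose_mul)
  then have "matrix_inv M = transpose (matrix_inv M)"
    by (intro matrix_inv_unique) (simp add: matrix_inv_inverse[OF assms(1)])
  then have "matrix_inv M $ i $ j = transpose (matrix_inv M) $ i $ j" by (rule arg_cong)
  then show ?thesis unfolding transpose_def vec_lambda_beta .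
qed

lemma det_differentiable:
  fixes M :: "real^'k::finite \<Rightarrow> real^'n^'n"
  assumes "\<And>i j. (\<lambda>v. M v $ i $ j) differentiable (at u)"
  shows "(\<lambda>v. det (M v)) differentiable (at u)"
proof -
  have "(\<lambda>v. \<Prod>i\<in>UNIV. M v $ i $ p i) differentiable (at u)" for p
    using has_derivative_prod[of UNIV "\<lambda>i v. M v $ i $ p i"] has_frechet_derivative[OF assms]
    unfolding differentiable_def by fast
  then show ?thesis
    unfolding det_def by (intro differentiable_sum ballI differentiable_mult finite_permutations) auto
qed

lemma det_replace_row:
  fixes M :: "real^'n^'n"
  assumes "det M \<noteq> 0"
  shows "det (\<chi> i. if i = k then w else M $ i) = (\<Sum>j\<in>UNIV. w $ j * matrix_inv M $ j $ k) * det M"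
proof -
  define z where "z = w v* matrix_inv M"
  have "w = z v* M"
    by (simp add: z_def vector_matrix_mul_assoc matrix_inv_inverse[OF assms])
  then have "w = (\<Sum>i\<in>UNIV. z $ i *s row i M)"
    by (simp add: vec_eq_iff vector_matrix_mult_def row_def mult.commute)
  then have "(\<chi> i. if i = k then w else M $ i) = (\<chi> i. if i = k then (\<Sum>i\<in>UNIV. z $ i *s row i M) else row i M)"
    by (simp add: row_def vec_eq_iff)
  moreover have "z $ k = (\<Sum>j\<in>UNIV. w $ j * matrix_inv M $ j $ k)"
    by (simp add: z_def vector_matrix_mult_def mult.commute)
  ultimately show ?thesis using cramer_lemma_transpose[of k z M] by simp
qed

lemma partial_det:
  fixes M :: "real^'k::finite \<Rightarrow> real^'n^'n"
  assumes M: "\<And>i j. (\<lambda>v. M v $ i $ j) differentiable (at u)" and nz: "det (M u) \<noteq> 0"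
  shows "partial l (\<lambda>v. det (M v)) u
    = det (M u) * (\<Sum>i\<in>UNIV. \<Sum>j\<in>UNIV. matrix_inv (M u) $ j $ i * partial l (\<lambda>v. M v $ i $ j) u)"
proof -
  define D where "D i j = partial l (\<lambda>v. M v $ i $ j) u" for i j
  have dprod: "((\<lambda>v. \<Prod>i\<in>UNIV. M v $ i $ p i) has_derivative
      (\<lambda>y. \<Sum>i\<in>UNIV. frechet_derivative (\<lambda>v. M v $ i $ p i) (at u) y * (\<Prod>j\<in>UNIV - {i}. M u $ j $ p j))) (at u)"
    for p
    by (intro has_derivative_prod has_frechet_derivative M)
  have dp: "(\<lambda>v. \<Prod>i\<in>UNIV. M v $ i $ p i) differentiable (at u)" for p
    using dprod differentiableI by blast
  have pp: "partial l (\<lambda>v. \<Prod>i\<in>UNIV. M v $ i $ p i) u = (\<Sum>i\<in>UNIV. \<Prod>j\<in>UNIV. (if j = i then D i (p i) else M u $ j $ p j))"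
    for p
    unfolding partial_eqI[OF dprod]
  proof (rule sum.cong[OF refl])
    fix i
    have "(\<Prod>j\<in>UNIV. (if j = i then D i (p i) else M u $ j $ p j))
      = D i (p i) * (\<Prod>j\<in>UNIV - {i}. (if j = i then D i (p i) else M u $ j $ p j))"
      by (subst prod.remove[of UNIV i]) auto
    also have "(\<Prod>j\<in>UNIV - {i}. (if j = i then D i (p i) else M u $ j $ p j)) = (\<Prod>j\<in>UNIV - {i}. M u $ j $ p j)"
      by (rule prod.cong) auto
    finally show "frechet_derivative (\<lambda>v. M v $ i $ p i) (at u) (axis l 1) * (\<Prod>j\<in>UNIV - {i}. M u $ j $ p j)
      = (\<Prod>j\<in>UNIV. (if j = i then D i (p i) else M u $ j $ p j))"
      by (simp add: D_def partial_def)
  qed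
  have "partial l (\<lambda>v. det (M v)) u
    = (\<Sum>p | p permutes UNIV. of_int (sign p) * (\<Sum>i\<in>UNIV. \<Prod>j\<in>UNIV. (if j = i then D i (p i) else M u $ j $ p j)))"
    unfolding det_def
    by (subst partial_sum) (auto simp: partial_mult dp pp)
  also have "\<dots> = (\<Sum>i\<in>UNIV. det (\<chi> j. if j = i then (\<chi> k. D i k) else M u $ j))"
    unfolding det_def sum_distrib_left
    by (subst sum.swap) (auto intro!: sum.cong prod.cong)
  also have "\<dots> = det (M u) * (\<Sum>i\<in>UNIV. \<Sum>j\<in>UNIV. matrix_inv (M u) $ j $ i * D i j)"
    by (simp add: det_replace_row[OF nz] sum_distrib_left sum_distrib_right mult_ac)
  finally show ?thesis unfolding D_def .
qed

lemma matrix_inv_cramer: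
  fixes M :: "real^'n^'n"
  assumes "det M \<noteq> 0"
  shows "matrix_inv M $ i $ j = det (\<chi> a b. if b = i then axis j 1 $ a else M $ a $ b) / det M"
proof -
  define x where "x = matrix_inv M *v axis j 1"
  have Mx: "M *v x = axis j 1"
    by (simp add: x_def matrix_vector_mul_assoc matrix_inv_inverse[OF assms])
  have xi: "x $ i = matrix_inv M $ i $ j"
    by (simp add: x_def matrix_vector_mul_component inner_axis)
  show ?thesis
    using cramer_lemma[where k = i and A = M and x = x, symmetric] unfolding Mx xi
    by (rule eq_divide_imp[OF assms])
qed

lemma matrix_inv_differentiable:
  fixes M :: "real^'k::finite \<Rightarrow> real^'n^'n"
  assumes M: "\<And>i j. (\<lambda>v. M v $ i $ j) differentiable (at u)"
    and S: "open S" "u \<in> S" and nz: "\<And>v. v \<in> S \<Longrightarrow> det (M v) \<noteq> 0"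
  shows "(\<lambda>v. matrix_inv (M v) $ i $ j) differentiable (at u)"
proof -
  have "(\<lambda>v. if b = i then axis j (1::real) $ a else M v $ a $ b) differentiable (at u)" for a b
    by (cases "b = i") (simp_all add: M)
  then have "(\<lambda>v. det (\<chi> a b. if b = i then axis j 1 $ a else M v $ a $ b) / det (M v)) differentiable (at u)"
    by (intro differentiable_divide det_differentiable M nz S(2)) (simp only: vec_lambda_beta)
  then show ?thesis
    by (rule differentiable_transform_open[OF S]) (simp only: matrix_inv_cramer[OF nz])
qed

section \<open>Contractions of covariant tensors of order three\<close>

definition raise3 :: "real^'n^'n \<Rightarrow> ('n \<Rightarrow> 'n \<Rightarrow> 'n \<Rightarrow> real) \<Rightarrow> 'n \<Rightarrow> 'n \<Rightarrow> 'n \<Rightarrow> real" where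
  "raise3 H R j k l = (\<Sum>a\<in>UNIV. \<Sum>b\<in>UNIV. \<Sum>c\<in>UNIV. H $ j $ a * H $ k $ b * H $ l $ c * R a b c)"

definition contract3 :: "real^'n^'n \<Rightarrow> ('n \<Rightarrow> 'n \<Rightarrow> 'n \<Rightarrow> real) \<Rightarrow> ('n \<Rightarrow> 'n \<Rightarrow> 'n \<Rightarrow> real) \<Rightarrow> real" where
  "contract3 H S R = (\<Sum>j\<in>UNIV. \<Sum>k\<in>UNIV. \<Sum>l\<in>UNIV. S j k l * raise3 H R j k l)"

definition sym_product :: "('n \<Rightarrow> real) \<Rightarrow> real^'n^'n \<Rightarrow> 'n \<Rightarrow> 'n \<Rightarrow> 'n \<Rightarrow> real" where
  "sym_product t G j k l = t j * G $ k $ l + t k * G $ j $ l + t l * G $ j $ k"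

lemma raise3_add: "raise3 H (\<lambda>a b c. R a b c + R' a b c) j k l = raise3 H R j k l + raise3 H R' j k l"
  by (simp add: raise3_def algebra_simps sum.distrib)

lemma raise3_scale: "raise3 H (\<lambda>a b c. s * R a b c) j k l = s * raise3 H R j k l"
  by (simp add: raise3_def sum_distrib_left mult_ac)

lemma raise3_scale_metric: "raise3 (s *\<^sub>R H) R j k l = s ^ 3 * raise3 H R j k l"
  by (simp add: raise3_def sum_distrib_left mult_ac power3_eq_cube)

lemma raise3_swap12: "raise3 H (\<lambda>a b c. R b a c) j k l = raise3 H R k j l"
  unfolding raise3_def by (subst sum.swap) (simp add: mult_ac)

lemma raise3_swap23: "raise3 H (\<lambda>a b c. R a c b) j k l = raise3 H R j l k"
  unfolding raise3_def by (rule sum.cong[OF refl], subst sum.swap) (simp add: mult_ac)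

lemma raise3_tensor_metric:
  assumes sym: "\<And>i j. H $ i $ j = H $ j $ i"
    and inv: "\<And>i j. (\<Sum>k\<in>UNIV. H $ i $ k * G $ k $ j) = (if i = j then 1 else 0)"
  shows "raise3 H (\<lambda>a b c. t a * G $ b $ c) j k l = (\<Sum>a\<in>UNIV. H $ j $ a * t a) * H $ k $ l"
proof -
  have "raise3 H (\<lambda>a b c. t a * G $ b $ c) j k l
    = (\<Sum>a\<in>UNIV. H $ j $ a * t a * (\<Sum>c\<in>UNIV. H $ l $ c * (\<Sum>b\<in>UNIV. H $ k $ b * G $ b $ c)))"
    unfolding raise3_def sum_distrib_left
    by (rule sum.cong[OF refl], subst sum.swap) (simp add: mult_ac)
  also have "\<dots> = (\<Sum>a\<in>UNIV. H $ j $ a * t a * H $ k $ l)"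
    by (simp add: inv if_distrib[of "\<lambda>x. _ * x"] sym[of l k] cong: if_cong)
  finally show ?thesis by (simp add: sum_distrib_right)
qed

lemma raise3_sym_product:
  assumes sym: "\<And>i j. H $ i $ j = H $ j $ i"
    and inv: "\<And>i j. (\<Sum>k\<in>UNIV. H $ i $ k * G $ k $ j) = (if i = j then 1 else 0)"
  shows "raise3 H (sym_product t G) = sym_product (\<lambda>j. \<Sum>a\<in>UNIV. H $ j $ a * t a) H"
proof (intro ext)
  fix j k l
  note r = raise3_tensor_metric[OF sym inv, of t]
  have "raise3 H (\<lambda>a b c. t b * G $ a $ c) j k l = (\<Sum>a\<in>UNIV. H $ k $ a * t a) * H $ j $ l"
    using raise3_swap12[of H "\<lambda>a b c. t a * G $ b $ c"] r by simp
  moreover have "raise3 H (\<lambda>a b c. t c * G $ a $ b) j k l = (\<Sum>a\<in>UNIV. H $ l $ a * t a) * H $ j $ k"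
    using raise3_swap23[of H "\<lambda>a b c. t b * G $ a $ c"] raise3_swap12[of H "\<lambda>a b c. t a * G $ b $ c"] r
    by simp
  ultimately show "raise3 H (sym_product t G) j k l = sym_product (\<lambda>j. \<Sum>a\<in>UNIV. H $ j $ a * t a) H j k l"
    unfolding sym_product_def using r by (simp add: raise3_add)
qed

lemma contract3_commute:
  assumes sym: "\<And>i j. H $ i $ j = H $ j $ i"
  shows "contract3 H S R = contract3 H R S"
proof -
  let ?t = "\<lambda>(j, k, l) (a, b, c). H $ j $ a * H $ k $ b * H $ l $ c * S j k l * R a b c"
  have exp: "(\<Sum>j\<in>UNIV. \<Sum>k\<in>UNIV. \<Sum>l\<in>UNIV. g j k l) = (\<Sum>(j, k, l)\<in>UNIV. g j k l)"
    for g :: "'a \<Rightarrow> 'a \<Rightarrow> 'a \<Rightarrow> real"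
    by (simp add: sum.cartesian_product split_def flip: UNIV_Times_UNIV)
  have "contract3 H S R = (\<Sum>p\<in>UNIV. \<Sum>q\<in>UNIV. ?t p q)"
    unfolding contract3_def raise3_def exp by (simp add: split_def sum_distrib_left mult_ac)
  also have "\<dots> = (\<Sum>p\<in>UNIV. \<Sum>q\<in>UNIV. ?t q p)"
    by (rule sum.swap)
  also have "\<dots> = contract3 H R S"
    unfolding contract3_def raise3_def exp
    by (simp add: split_def sum_distrib_left mult_ac) (simp add: sym)
  finally show ?thesis .
qed

lemma sum_sym_product:
  assumes V12: "\<And>j k l. V j k l = V k j l" and V23: "\<And>j k l. V j k l = (V j l k :: real)"
  shows "(\<Sum>j\<in>UNIV. \<Sum>k\<in>UNIV. \<Sum>l\<in>UNIV. sym_product t G j k l * V j k l)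
    = 3 * (\<Sum>j\<in>UNIV. t j * (\<Sum>k\<in>UNIV. \<Sum>l\<in>UNIV. G $ k $ l * V j k l))"
proof -
  let ?W = "\<Sum>j\<in>UNIV. \<Sum>k\<in>UNIV. \<Sum>l\<in>UNIV. t j * G $ k $ l * V j k l"
  have 2: "(\<Sum>j\<in>UNIV. \<Sum>k\<in>UNIV. \<Sum>l\<in>UNIV. t k * G $ j $ l * V j k l) = ?W"
    by (subst sum.swap) (subst V12, rule refl)
  have "(\<Sum>j\<in>UNIV. \<Sum>k\<in>UNIV. \<Sum>l\<in>UNIV. t l * G $ j $ k * V j k l)
    = (\<Sum>j\<in>UNIV. \<Sum>l\<in>UNIV. \<Sum>k\<in>UNIV. t l * G $ j $ k * V j l k)"
    by (rule sum.cong[OF refl], subst sum.swap) (subst V23, rule refl)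
  with 2 have 3: "(\<Sum>j\<in>UNIV. \<Sum>k\<in>UNIV. \<Sum>l\<in>UNIV. t l * G $ j $ k * V j k l) = ?W" by simp
  have "(\<Sum>j\<in>UNIV. t j * (\<Sum>k\<in>UNIV. \<Sum>l\<in>UNIV. G $ k $ l * V j k l)) = ?W"
    by (simp add: sum_distrib_left mult_ac)
  with 2 3 show ?thesis
    by (simp add: sym_product_def distrib_right sum.distrib)
qed

lemma trace_sym_product:
  fixes G H :: "real^'n::finite^'n"
  assumes sym: "\<And>i j. H $ i $ j = H $ j $ i" "\<And>i j. G $ i $ j = G $ j $ i"
    and inv: "\<And>i j. (\<Sum>k\<in>UNIV. H $ i $ k * G $ k $ j) = (if i = j then 1 else 0)"
  shows "(\<Sum>k\<in>UNIV. \<Sum>l\<in>UNIV. G $ k $ l * sym_product t H j k l) = (real CARD('n) + 2) * t j"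
proof -
  have "(\<Sum>l\<in>UNIV. G $ k $ l * (t j * H $ k $ l)) = t j" for k
    using inv[of k k] sym by (simp add: sum_distrib_left mult_ac flip: sum_distrib_left)
  moreover have "(\<Sum>l\<in>UNIV. G $ k $ l * (t k * H $ j $ l)) = t k * (if j = k then 1 else 0)" for k
    using inv[of j k] sym by (simp add: mult_ac flip: sum_distrib_left)
  moreover have "(\<Sum>k\<in>UNIV. \<Sum>l\<in>UNIV. G $ k $ l * (t l * H $ j $ k)) = (\<Sum>l\<in>UNIV. t l * (if j = l then 1 else 0))"
    by (subst sum.swap) (simp add: mult_ac flip: sum_distrib_left inv)
  ultimately show ?thesis
    by (simp add: sym_product_def distrib_left sum.distrib algebra_simps if_distrib[of "\<lambda>x. _ * x"] cong: if_cong)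
qed

lemma contract3_add_sym_product:
  fixes G H :: "real^'n::finite^'n"
  assumes sym: "\<And>i j. H $ i $ j = H $ j $ i" "\<And>i j. G $ i $ j = G $ j $ i"
    and inv: "\<And>i j. (\<Sum>k\<in>UNIV. H $ i $ k * G $ k $ j) = (if i = j then 1 else 0)"
    and A: "\<And>j k l. A j k l = A k j l" "\<And>j k l. A j k l = A j l k"
    and apolar: "\<And>j. (\<Sum>k\<in>UNIV. \<Sum>l\<in>UNIV. H $ k $ l * A j k l) = 0"
  shows "contract3 H (\<lambda>j k l. A j k l + sym_product t G j k l) (\<lambda>j k l. A j k l + sym_product t G j k l)
    = contract3 H A A + 3 * (real CARD('n) + 2) * (\<Sum>j\<in>UNIV. \<Sum>k\<in>UNIV. H $ j $ k * t j * t k)"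
proof -
  let ?S = "sym_product t G" and ?t = "\<lambda>j. \<Sum>a\<in>UNIV. H $ j $ a * t a"
  have rS: "raise3 H ?S = sym_product ?t H"
    using raise3_sym_product[OF sym(1) inv] .
  have AS: "contract3 H A ?S = 0"
    using sum_sym_product[of A, OF A, of ?t H] unfolding contract3_def rS apolar by (simp add: mult.commute)
  have V: "sym_product ?t H j k l = sym_product ?t H k j l" "sym_product ?t H j k l = sym_product ?t H j l k" for j k l
    unfolding sym_product_def using sym by auto
  have SS: "contract3 H ?S ?S = 3 * (real CARD('n) + 2) * (\<Sum>j\<in>UNIV. \<Sum>k\<in>UNIV. H $ j $ k * t j * t k)"
    unfolding contract3_def rS sum_sym_product[of "sym_product ?t H", OF V] trace_sym_product[OF sym inv]
    by (simp add: sum_distrib_left algebra_simps)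
  have "contract3 H (\<lambda>j k l. A j k l + ?S j k l) (\<lambda>j k l. A j k l + ?S j k l)
    = contract3 H A A + contract3 H A ?S + contract3 H ?S A + contract3 H ?S ?S"
    unfolding contract3_def raise3_add by (simp add: algebra_simps sum.distrib)
  then show ?thesis using AS SS contract3_commute[OF sym(1), of ?S A] by simp
qed

lemma contract3_scale:
  "contract3 (s *\<^sub>R H) (\<lambda>j k l. c * A j k l) (\<lambda>j k l. c * A j k l) = s ^ 3 * c\<^sup>2 * contract3 H A A"
  by (simp add: contract3_def raise3_scale_metric raise3_scale sum_distrib_left power2_eq_square mult_ac)

section \<open>Relative normalizations in local coordinates\<close>

locale local_normalization =
  fixes S :: "(real^'n::finite) set" and f y :: "real^'n \<Rightarrow> real^'m::finite"
  assumes open_S: "open S" and card: "CARD('m) = CARD('n) + 1"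
    and f: "Ck_on 4 f S"
    and y: "\<And>v. v \<in> S \<Longrightarrow> y differentiable (at v)"
    and indep: "\<And>v a b. v \<in> S \<Longrightarrow> (\<Sum>i\<in>UNIV. a i *\<^sub>R partial i f v) + b *\<^sub>R y v = 0 \<Longrightarrow> (\<forall>i. a i = 0) \<and> b = 0"
    and tangential: "\<And>v i. v \<in> S \<Longrightarrow> partial i y v \<in> span (range (\<lambda>j. partial j f v))"
begin

abbreviation "X \<equiv> covector f y"
abbreviation "G \<equiv> relative_metric f y"
abbreviation "g \<equiv> first_form f"

lemma f_differentiable:
  assumes "v \<in> S"
  shows "f differentiable (at v)" "partial i f differentiable (at v)"
    "partial j (partial i f) differentiable (at v)" "partial k (partial j (partial i f)) differentiable (at v)"
  using f assms by (simp_all add: eval_nat_numeral partial_def[abs_def])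

lemma partial2_commute: "v \<in> S \<Longrightarrow> partial i (partial j f) v = partial j (partial i f) v"
  by (rule partial_commute[OF open_S]) (auto intro: f_differentiable)

lemma partial3_commute:
  assumes "v \<in> S"
  shows "partial i (partial j (partial k f)) v = partial j (partial i (partial k f)) v"
    and "partial i (partial j (partial k f)) v = partial i (partial k (partial j f)) v"
proof -
  show "partial i (partial j (partial k f)) v = partial j (partial i (partial k f)) v"
    by (rule partial_commute[OF open_S assms]) (simp_all add: f_differentiable assms)
  show "partial i (partial j (partial k f)) v = partial i (partial k (partial j f)) v"
    by (rule partial_transform[OF open_S assms f_differentiable(3)[OF assms]]) (rule partial2_commute)
qed

lemma gram_nonsingular:
  assumes v: "v \<in> S"
  shows "det (g v) \<noteq> 0"
proof -
  have "w = 0" if "g v *v w = 0" for w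
  proof -
    define s where "s = (\<Sum>i\<in>UNIV. w $ i *\<^sub>R partial i f v)"
    have *: "s \<bullet> partial j f v = (g v *v w) $ j" for j
      unfolding s_def inner_sum_left matrix_vector_mult_def first_form_def
      by (simp add: inner_commute mult.commute)
    have "s \<bullet> s = (\<Sum>j\<in>UNIV. w $ j * (s \<bullet> partial j f v))"
      by (subst (2) s_def) (simp only: inner_sum_right inner_scaleR_right)
    also have "\<dots> = 0"
      unfolding * that by simp
    finally have "s = 0" by simp
    then have "(\<Sum>i\<in>UNIV. w $ i *\<^sub>R partial i f v) + 0 *\<^sub>R y v = 0"
      unfolding s_def by simp
    from indep[OF v this] show "w = 0" by (simp add: vec_eq_iff)
  qed
  then have "\<exists>B. B ** g v = mat 1"
    unfolding matrix_left_invertible_ker by blast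
  then show ?thesis
    unfolding invertible_left_inverse[symmetric] invertible_det_nz .
qed

lemma gram_inv:
  assumes "v \<in> S"
  shows "(\<Sum>j\<in>UNIV. matrix_inv (g v) $ i $ j * (partial j f v \<bullet> partial k f v)) = (if i = k then 1 else 0)"
    and "matrix_inv (g v) $ i $ j = matrix_inv (g v) $ j $ i"
proof -
  show "(\<Sum>j\<in>UNIV. matrix_inv (g v) $ i $ j * (partial j f v \<bullet> partial k f v)) = (if i = k then 1 else 0)"
    using sum_matrix_inv(2)[OF gram_nonsingular[OF assms], of i k] by (simp add: first_form_def)
  show "matrix_inv (g v) $ i $ j = matrix_inv (g v) $ j $ i"
    by (rule matrix_inv_symmetric[OF gram_nonsingular[OF assms]]) (simp add: first_form_def inner_commute)
qed

lemma eq_zero_if_orthogonal: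
  assumes v: "v \<in> S" and Z: "\<And>i. Z \<bullet> partial i f v = 0" "Z \<bullet> y v = 0"
  shows "Z = 0"
proof -
  define L where "L p = (\<Sum>i\<in>UNIV. fst p $ i *\<^sub>R partial i f v) + snd p *\<^sub>R y v" for p :: "(real^'n) \<times> real"
  have lin: "linear L"
    by (rule linearI) (simp_all add: L_def sum.distrib scaleR_left_distrib scaleR_sum_right scaleR_right_distrib)
  have "inj L"
    unfolding linear_injective_0[OF lin]
  proof (intro allI impI)
    fix p assume "L p = 0"
    from indep[OF v this[unfolded L_def]] show "p = 0" by (simp add: prod_eq_iff vec_eq_iff)
  qed
  then have "dim (range L) = DIM(real^'m)"
    using dim_image_eq[OF lin, of UNIV] card by (simp add: dim_UNIV)
  then have "span (range L) = UNIV"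
    by (simp only: dim_eq_full)
  moreover have "span (range L) = range L"
    using linear_subspace_image[OF lin subspace_UNIV] by (simp only: span_eq_iff)
  ultimately have "range L = UNIV" by simp
  then obtain p where "Z = L p" by blast
  then have "Z \<bullet> Z = 0"
    using Z by (simp add: L_def inner_sum_right inner_add_right)
  then show ?thesis by simp
qed

lemma covector_unique:
  assumes v: "v \<in> S" and Z: "\<And>i. Z \<bullet> partial i f v = 0" "Z \<bullet> y v = 1"
  shows "X v = Z"
  unfolding covector_def
proof (rule the_equality)
  fix Z' assume "(\<forall>i. Z' \<bullet> partial i f v = 0) \<and> Z' \<bullet> y v = 1"
  then have "Z' - Z = 0"
    by (intro eq_zero_if_orthogonal[OF v]) (simp_all add: Z inner_diff_left)
  then show "Z' = Z" by simp
qed (use Z in auto)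

definition normal_part :: "real^'n \<Rightarrow> real^'m" where
  "normal_part v = y v - (\<Sum>i\<in>UNIV. (\<Sum>j\<in>UNIV. matrix_inv (g v) $ i $ j * (y v \<bullet> partial j f v)) *\<^sub>R partial i f v)"

lemma normal_part:
  assumes v: "v \<in> S"
  shows "normal_part v \<bullet> partial k f v = 0" "normal_part v \<bullet> y v = normal_part v \<bullet> normal_part v"
    "normal_part v \<noteq> 0"
proof -
  have "(\<Sum>i\<in>UNIV. (\<Sum>j\<in>UNIV. matrix_inv (g v) $ i $ j * (y v \<bullet> partial j f v)) * (partial i f v \<bullet> partial k f v))
    = (\<Sum>j\<in>UNIV. (y v \<bullet> partial j f v) * (\<Sum>i\<in>UNIV. matrix_inv (g v) $ j $ i * (partial i f v \<bullet> partial k f v)))" for k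
    unfolding sum_distrib_left sum_distrib_right
    by (subst sum.swap) (simp add: gram_inv(2)[OF v] mult_ac)
  also have "\<dots> k = y v \<bullet> partial k f v" for k
    by (simp add: gram_inv(1)[OF v] if_distrib[of "\<lambda>x. _ * x"] cong: if_cong)
  finally show *: "normal_part v \<bullet> partial k f v = 0" for k
    by (simp add: normal_part_def inner_diff_left inner_sum_left)
  then show "normal_part v \<bullet> y v = normal_part v \<bullet> normal_part v"
    using arg_cong[OF normal_part_def[of v], of "\<lambda>w. normal_part v \<bullet> w"]
    by (simp add: inner_diff_right inner_sum_right)
  show "normal_part v \<noteq> 0"
    using indep[OF v, of "\<lambda>i. - (\<Sum>j\<in>UNIV. matrix_inv (g v) $ i $ j * (y v \<bullet> partial j f v))" 1]
    by (auto simp: normal_part_def sum_negf)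
qed

lemma covector_eq:
  assumes v: "v \<in> S"
  shows "X v = (1 / (normal_part v \<bullet> normal_part v)) *\<^sub>R normal_part v"
  by (rule covector_unique[OF v]) (use normal_part[OF v] in simp_all)

lemma covector:
  assumes v: "v \<in> S"
  shows "X v \<bullet> partial i f v = 0" "X v \<bullet> y v = 1" "X v \<bullet> X v > 0"
  unfolding covector_eq[OF v] using normal_part[OF v] by simp_all

lemma gram_inv_differentiable:
  assumes "v \<in> S"
  shows "(\<lambda>v. matrix_inv (g v) $ i $ j) differentiable (at v)"
proof (rule matrix_inv_differentiable[OF _ open_S assms gram_nonsingular])
  show "(\<lambda>v. g v $ i $ j) differentiable (at v)" for i j
    using f_differentiable(2)[OF assms] by (simp add: first_form_def)
qed

lemma covector_differentiable:
  assumes v: "v \<in> S"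
  shows "X differentiable (at v)"
proof (rule differentiable_transform_open[OF open_S v _ covector_eq[symmetric]])
  have "normal_part differentiable (at v)"
    unfolding normal_part_def[abs_def]
    by (intro differentiable_diff differentiable_sum ballI differentiable_scaleR differentiable_mult
        differentiable_inner gram_inv_differentiable y f_differentiable v) auto
  then show "(\<lambda>v. (1 / (normal_part v \<bullet> normal_part v)) *\<^sub>R normal_part v) differentiable (at v)"
    using normal_part(3)[OF v] by (intro differentiable_scaleR differentiable_divide differentiable_inner) auto
qed

lemma partial_covector_inner:
  assumes v: "v \<in> S"
  shows "partial l X v \<bullet> partial i f v = - (X v \<bullet> partial l (partial i f) v)"
    and "partial l X v \<bullet> y v = 0"
proof -
  have "partial l (\<lambda>v. X v \<bullet> partial i f v) v = partial l (\<lambda>v. 0 :: real) v"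
    by (rule partial_transform[OF open_S v]) (simp_all add: covector)
  then show "partial l X v \<bullet> partial i f v = - (X v \<bullet> partial l (partial i f) v)"
    by (simp add: partial_inner covector_differentiable f_differentiable v)
  have "partial l (\<lambda>v. X v \<bullet> y v) v = partial l (\<lambda>v. 1 :: real) v"
    by (rule partial_transform[OF open_S v]) (simp_all add: covector)
  moreover have "X v \<bullet> w = 0" if "w \<in> span (range (\<lambda>j. partial j f v))" for w
    using that by (induction rule: span_induct_alt) (auto simp: inner_add_right covector v)
  ultimately show "partial l X v \<bullet> y v = 0"
    using tangential[OF v] by (simp add: partial_inner covector_differentiable y v)
qed

lemma partial_covector:
  assumes v: "v \<in> S"
  defines "W \<equiv> \<lambda>l v. \<Sum>i\<in>UNIV. (\<Sum>j\<in>UNIV. matrix_inv (g v) $ i $ j * (X v \<bullet> partial l (partial j f) v)) *\<^sub>R partial i f v"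
  shows "partial l X v = (W l v \<bullet> y v) *\<^sub>R X v - W l v"
proof -
  have Wf: "W l v \<bullet> partial k f v = X v \<bullet> partial l (partial k f) v" for k
  proof -
    have "W l v \<bullet> partial k f v
      = (\<Sum>j\<in>UNIV. (X v \<bullet> partial l (partial j f) v) * (\<Sum>i\<in>UNIV. matrix_inv (g v) $ j $ i * (partial i f v \<bullet> partial k f v)))"
      unfolding W_def inner_sum_left inner_scaleR_left sum_distrib_left sum_distrib_right
      by (subst sum.swap) (simp add: gram_inv(2)[OF v] mult_ac)
    also have "\<dots> = X v \<bullet> partial l (partial k f) v"
      by (simp add: gram_inv(1)[OF v] if_distrib[of "\<lambda>x. _ * x"] cong: if_cong)
    finally show ?thesis .
  qed
  have "partial l X v - ((W l v \<bullet> y v) *\<^sub>R X v - W l v) = 0"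
    by (rule eq_zero_if_orthogonal[OF v])
      (simp_all add: inner_diff_left inner_add_left partial_covector_inner[OF v] covector[OF v] Wf)
  then show ?thesis by simp
qed

lemma partial_covector_differentiable:
  assumes v: "v \<in> S"
  shows "partial l X differentiable (at v)"
  by (rule differentiable_transform_open[OF open_S v _ partial_covector[symmetric]])
    (intro differentiable_diff differentiable_sum ballI differentiable_scaleR differentiable_mult
        differentiable_inner gram_inv_differentiable covector_differentiable y f_differentiable v; simp)+

lemma metric_nth: "G v $ i $ j = X v \<bullet> partial j (partial i f) v"
  by (simp add: relative_metric_def second_form_def)

lemma metric_sym: "v \<in> S \<Longrightarrow> G v $ i $ j = G v $ j $ i"
  by (simp add: metric_nth partial2_commute)

lemma metric_differentiable: "v \<in> S \<Longrightarrow> (\<lambda>v. G v $ i $ j) differentiable (at v)"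
  unfolding metric_nth by (intro differentiable_inner covector_differentiable f_differentiable)

lemma partial_metric:
  assumes v: "v \<in> S"
  shows "partial l (\<lambda>v. G v $ i $ j) v
    = X v \<bullet> partial l (partial j (partial i f)) v + partial l X v \<bullet> partial j (partial i f) v"
  unfolding metric_nth by (intro partial_inner covector_differentiable f_differentiable v)

lemma partial_metric_sym:
  assumes v: "v \<in> S"
  shows "partial l (\<lambda>v. G v $ i $ j) v = partial l (\<lambda>v. G v $ j $ i) v"
  using v by (simp add: partial_metric partial2_commute partial3_commute(2))

lemma partial_metric_differentiable:
  assumes v: "v \<in> S"
  shows "partial l (\<lambda>v. G v $ i $ j) differentiable (at v)"
  by (rule differentiable_transform_open[OF open_S v _ partial_metric[symmetric]])
    (intro differentiable_add differentiable_inner covector_differentiable partial_covector_differentiable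
        f_differentiable v; simp)+

end

locale local_nondegenerate = local_normalization S f y
  for S :: "(real^'n::finite) set" and f y :: "real^'n \<Rightarrow> real^'m::finite" +
  assumes metric_nonsingular: "\<And>v. v \<in> S \<Longrightarrow> det (G v) \<noteq> 0"
begin

abbreviation "H v \<equiv> matrix_inv (G v)"

lemma metric_inv:
  assumes "v \<in> S"
  shows "(\<Sum>k\<in>UNIV. H v $ i $ k * G v $ k $ j) = (if i = j then 1 else 0)"
    and "H v $ i $ j = H v $ j $ i"
  by (rule sum_matrix_inv(2)[OF metric_nonsingular[OF assms]])
    (rule matrix_inv_symmetric[OF metric_nonsingular[OF assms] metric_sym[OF assms]])

lemma christoffel_differentiable:
  assumes v: "v \<in> S"
  shows "christoffel G m j k differentiable (at v)"
proof -
  have "(\<lambda>v. H v $ m $ l) differentiable (at v)" for l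
    by (rule matrix_inv_differentiable[OF metric_differentiable[OF v] open_S v metric_nonsingular])
  then show ?thesis
    unfolding christoffel_def[abs_def]
    by (intro differentiable_divide differentiable_sum ballI differentiable_mult differentiable_diff
        differentiable_add partial_metric_differentiable v differentiable_const) auto
qed

lemma christoffel_lower:
  assumes v: "v \<in> S"
  shows "(\<Sum>m\<in>UNIV. christoffel G m j k v * G v $ m $ l)
    = (partial j (\<lambda>v. G v $ k $ l) v + partial k (\<lambda>v. G v $ j $ l) v - partial l (\<lambda>v. G v $ j $ k) v) / 2"
proof -
  define D where "D l = (partial j (\<lambda>v. G v $ k $ l) v + partial k (\<lambda>v. G v $ j $ l) v - partial l (\<lambda>v. G v $ j $ k) v) / 2" for l
  have "christoffel G m j k v = (\<Sum>i\<in>UNIV. D i * H v $ i $ m)" for m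
    unfolding christoffel_def D_def sum_divide_distrib
    by (simp add: metric_inv(2)[OF v, of m] mult.commute)
  then have "(\<Sum>m\<in>UNIV. christoffel G m j k v * G v $ m $ l)
    = (\<Sum>m\<in>UNIV. \<Sum>i\<in>UNIV. D i * (H v $ i $ m * G v $ m $ l))"
    by (simp only: sum_distrib_right mult.assoc)
  also have "\<dots> = (\<Sum>i\<in>UNIV. D i * (\<Sum>m\<in>UNIV. H v $ i $ m * G v $ m $ l))"
    unfolding sum_distrib_left by (rule sum.swap)
  also have "\<dots> = D l"
    by (simp add: metric_inv(1)[OF v] if_distrib[of "\<lambda>x. _ * x"] cong: if_cong)
  finally show ?thesis unfolding D_def .
qed

lemma covector_cov_deriv1:
  assumes v: "v \<in> S"
  shows "X v \<bullet> cov_deriv1 G (\<lambda>i. partial i f) k j v = G v $ j $ k"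
  by (simp add: cov_deriv1_def inner_diff_right inner_sum_right covector[OF v] metric_nth)

lemma covector_partial_cov_deriv1:
  assumes v: "v \<in> S"
  shows "X v \<bullet> partial l (cov_deriv1 G (\<lambda>i. partial i f) k j) v
    = X v \<bullet> partial l (partial k (partial j f)) v - (\<Sum>m\<in>UNIV. christoffel G m k j v * G v $ m $ l)"
proof -
  have "partial l (cov_deriv1 G (\<lambda>i. partial i f) k j) v
    = partial l (partial k (partial j f)) v
      - (\<Sum>m\<in>UNIV. christoffel G m k j v *\<^sub>R partial l (partial m f) v
        + partial l (christoffel G m k j) v *\<^sub>R partial m f v)"
    unfolding cov_deriv1_def[abs_def]
    by (simp add: partial_diff partial_sum partial_scaleR differentiable_sum differentiable_scaleR
        christoffel_differentiable f_differentiable v)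
  then show ?thesis
    by (simp add: inner_diff_right inner_sum_right inner_add_right covector[OF v] metric_nth)
qed

lemma darboux_metric:
  assumes v: "v \<in> S"
  shows "darboux f y j k l v = X v \<bullet> partial l (partial k (partial j f)) v
    - (partial j (\<lambda>v. G v $ k $ l) v + partial k (\<lambda>v. G v $ j $ l) v + partial l (\<lambda>v. G v $ j $ k) v) / 2"
proof -
  have "darboux f y j k l v = X v \<bullet> partial l (partial k (partial j f)) v
    - (\<Sum>m\<in>UNIV. christoffel G m k j v * G v $ m $ l)
    - (\<Sum>m\<in>UNIV. christoffel G m l j v * G v $ m $ k)
    - (\<Sum>m\<in>UNIV. christoffel G m l k v * G v $ m $ j)"
    unfolding darboux_def Let_def cov_deriv2_def
    by (simp add: inner_diff_right inner_sum_right covector_cov_deriv1[OF v] covector_partial_cov_deriv1[OF v]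
        metric_sym[OF v, of j])
  then show ?thesis
    unfolding christoffel_lower[OF v]
    using partial_metric_sym[OF v, of l j k] partial_metric_sym[OF v, of j l k] partial_metric_sym[OF v, of k l j]
    by (simp add: field_simps)
qed

lemma darboux_eq:
  assumes v: "v \<in> S"
  shows "darboux f y j k l v = - (X v \<bullet> partial l (partial k (partial j f)) v
    + partial j X v \<bullet> partial k (partial l f) v + partial k X v \<bullet> partial j (partial l f) v
    + partial l X v \<bullet> partial k (partial j f) v) / 2"
proof -
  have "partial j (partial l (partial k f)) v = partial l (partial k (partial j f)) v"
    "partial k (partial l (partial j f)) v = partial l (partial k (partial j f)) v"
    using partial3_commute[OF v] by metis+
  then show ?thesis
    unfolding darboux_metric[OF v] partial_metric[OF v]
    using partial2_commute[OF v, of l k] partial2_commute[OF v, of l j] by (simp add: field_simps)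
qed

lemma darboux_sym:
  assumes v: "v \<in> S"
  shows "darboux f y j k l v = darboux f y k j l v" "darboux f y j k l v = darboux f y j l k v"
proof -
  show "darboux f y j k l v = darboux f y k j l v"
    unfolding darboux_eq[OF v]
    using partial3_commute[OF v] partial2_commute[OF v] by (simp add: algebra_simps)
  show "darboux f y j k l v = darboux f y j l k v"
    unfolding darboux_eq[OF v] partial3_commute(1)[OF v, of l k j] partial2_commute[OF v, of k l]
      partial2_commute[OF v, of l j] partial2_commute[OF v, of k j]
    by (simp add: algebra_simps)
qed

lemma local_pick_contract3:
  "local_pick f y v = contract3 (H v) (\<lambda>j k l. darboux f y j k l v) (\<lambda>j k l. darboux f y j k l v)
    / (real CARD('n) * (real CARD('n) - 1))"
  by (simp add: local_pick_def contract3_def raise3_def darboux_up_def Let_def)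

text \<open>Apolarity: the hypothesis says that \<open>G\<close> and \<open>y\<close> induce the same volume form, and
  differentiating its logarithm gives the trace of the Darboux tensor.\<close>

lemma darboux_trace:
  assumes v: "v \<in> S" and vol: "\<And>v. v \<in> S \<Longrightarrow> det (G v) * (X v \<bullet> X v) = det (g v)"
  shows "(\<Sum>k\<in>UNIV. \<Sum>l\<in>UNIV. H v $ k $ l * darboux f y j k l v) = 0"
proof -
  define W where "W l = (\<Sum>a\<in>UNIV. (\<Sum>b\<in>UNIV. matrix_inv (g v) $ a $ b * (X v \<bullet> partial l (partial b f) v)) *\<^sub>R partial a f v)" for l
  define \<beta> where "\<beta> l = W l \<bullet> y v" for l
  define \<gamma> where "\<gamma> j = (\<Sum>a\<in>UNIV. \<Sum>b\<in>UNIV. matrix_inv (g v) $ a $ b * (partial a f v \<bullet> partial j (partial b f) v))" for j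
  have X': "partial l X v = \<beta> l *\<^sub>R X v - W l" for l
    unfolding W_def \<beta>_def by (rule partial_covector[OF v])
  have XX': "X v \<bullet> partial l X v = \<beta> l * (X v \<bullet> X v)" for l
    by (simp add: X' W_def inner_diff_right inner_sum_right covector[OF v])
  have trG: "(\<Sum>k\<in>UNIV. \<Sum>l\<in>UNIV. H v $ l $ k * partial j (\<lambda>v. G v $ k $ l) v) = 2 * \<gamma> j - 2 * \<beta> j"
  proof -
    have dg: "(\<lambda>v. g v $ a $ b) differentiable (at v)" for a b
      using f_differentiable(2)[OF v] by (simp add: first_form_def)
    have pg: "partial j (\<lambda>v. g v $ a $ b) v = partial a f v \<bullet> partial j (partial b f) v + partial j (partial a f) v \<bullet> partial b f v" for a b
      by (simp add: first_form_def partial_inner f_differentiable v)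
    have "(\<Sum>a\<in>UNIV. \<Sum>b\<in>UNIV. matrix_inv (g v) $ b $ a * partial j (\<lambda>v. g v $ a $ b) v) = 
      (\<Sum>a\<in>UNIV. \<Sum>b\<in>UNIV. matrix_inv (g v) $ b $ a * (partial a f v \<bullet> partial j (partial b f) v))
      + (\<Sum>a\<in>UNIV. \<Sum>b\<in>UNIV. matrix_inv (g v) $ b $ a * (partial j (partial a f) v \<bullet> partial b f v))"
      by (simp add: pg distrib_left sum.distrib)
    also have "(\<Sum>a\<in>UNIV. \<Sum>b\<in>UNIV. matrix_inv (g v) $ b $ a * (partial a f v \<bullet> partial j (partial b f) v)) = \<gamma> j"
      unfolding \<gamma>_def by (subst gram_inv(2)[OF v]) (rule refl)
    also have "(\<Sum>a\<in>UNIV. \<Sum>b\<in>UNIV. matrix_inv (g v) $ b $ a * (partial j (partial a f) v \<bullet> partial b f v)) = \<gamma> j"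
      unfolding \<gamma>_def by (subst sum.swap) (simp only: inner_commute)
    finally have trg: "(\<Sum>a\<in>UNIV. \<Sum>b\<in>UNIV. matrix_inv (g v) $ b $ a * partial j (\<lambda>v. g v $ a $ b) v) = 2 * \<gamma> j"
      by simp
    let ?t = "\<Sum>k\<in>UNIV. \<Sum>l\<in>UNIV. H v $ l $ k * partial j (\<lambda>v. G v $ k $ l) v"
    have dX: "(\<lambda>v. X v \<bullet> X v) differentiable (at v)"
      by (intro differentiable_inner covector_differentiable v)
    have dG: "(\<lambda>v. det (G v)) differentiable (at v)"
      by (intro det_differentiable metric_differentiable v)
    have "partial j (\<lambda>v. det (G v) * (X v \<bullet> X v)) v = det (G v) * (2 * \<beta> j * (X v \<bullet> X v)) + det (G v) * ?t * (X v \<bullet> X v)"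
      unfolding partial_mult[OF dG dX] partial_det[OF metric_differentiable[OF v] metric_nonsingular[OF v]]
        partial_inner[OF covector_differentiable[OF v] covector_differentiable[OF v]]
        inner_commute[of "partial j X v"] XX' by simp
    moreover have "partial j (\<lambda>v. det (G v) * (X v \<bullet> X v)) v = partial j (\<lambda>v. det (g v)) v"
      by (rule partial_transform[OF open_S v]) (intro det_differentiable dg, simp add: vol)
    moreover have "partial j (\<lambda>v. det (g v)) v = (det (G v) * (X v \<bullet> X v)) * (2 * \<gamma> j)"
      unfolding partial_det[OF dg gram_nonsingular[OF v]] trg vol[OF v] by simp
    ultimately have "(det (G v) * (X v \<bullet> X v)) * (2 * \<beta> j + ?t) = (det (G v) * (X v \<bullet> X v)) * (2 * \<gamma> j)"
      by (simp add: algebra_simps)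
    then have "2 * \<beta> j + ?t = 2 * \<gamma> j"
      using vol[OF v] gram_nonsingular[OF v] by (simp only: mult_cancel_left) simp
    then show ?thesis by simp
  qed
  have trX: "(\<Sum>k\<in>UNIV. \<Sum>l\<in>UNIV. H v $ k $ l * (partial k X v \<bullet> partial j (partial l f) v)) = \<beta> j - \<gamma> j"
  proof -
    have "(\<Sum>l\<in>UNIV. H v $ k $ l * (\<beta> k * (X v \<bullet> partial j (partial l f) v))) = \<beta> k * (if k = j then 1 else 0)" for k
      by (simp add: mult_ac metric_nth flip: metric_inv(1)[OF v] sum_distrib_left)
    then have 1: "(\<Sum>k\<in>UNIV. \<Sum>l\<in>UNIV. H v $ k $ l * (\<beta> k * (X v \<bullet> partial j (partial l f) v))) = \<beta> j"
      by (simp add: if_distrib[of "\<lambda>x. _ * x"] cong: if_cong)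
    have Wb: "W k \<bullet> w = (\<Sum>b\<in>UNIV. G v $ b $ k * (\<Sum>a\<in>UNIV. matrix_inv (g v) $ a $ b * (partial a f v \<bullet> w)))" for k w
      unfolding W_def inner_sum_left inner_scaleR_left sum_distrib_left sum_distrib_right metric_nth
      by (subst sum.swap) (simp add: mult_ac)
    have "(\<Sum>k\<in>UNIV. \<Sum>l\<in>UNIV. H v $ k $ l * (W k \<bullet> partial j (partial l f) v))
      = (\<Sum>l\<in>UNIV. \<Sum>k\<in>UNIV. \<Sum>b\<in>UNIV. (H v $ l $ k * G v $ k $ b) *
          (\<Sum>a\<in>UNIV. matrix_inv (g v) $ a $ b * (partial a f v \<bullet> partial j (partial l f) v)))"
      unfolding Wb sum_distrib_left[of "H v $ _ $ _"]
      by (subst sum.swap) (simp add: mult.assoc metric_inv(2)[OF v] metric_sym[OF v])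
    also have "\<dots> = (\<Sum>l\<in>UNIV. \<Sum>b\<in>UNIV. (\<Sum>k\<in>UNIV. H v $ l $ k * G v $ k $ b) *
          (\<Sum>a\<in>UNIV. matrix_inv (g v) $ a $ b * (partial a f v \<bullet> partial j (partial l f) v)))"
      unfolding sum_distrib_right[of "\<lambda>k. H v $ _ $ k * _ k"]
      by (rule sum.cong[OF refl]) (rule sum.swap)
    also have "\<dots> = (\<Sum>l\<in>UNIV. \<Sum>a\<in>UNIV. matrix_inv (g v) $ a $ l * (partial a f v \<bullet> partial j (partial l f) v))"
      by (simp add: metric_inv(1)[OF v] if_distrib[of "\<lambda>x. x * _"] cong: if_cong)
    also have "\<dots> = \<gamma> j" unfolding \<gamma>_def by (rule sum.swap)
    finally show ?thesis
      using 1 by (simp add: X' inner_diff_left right_diff_distrib sum_subtractf)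
  qed
  have trX': "(\<Sum>k\<in>UNIV. \<Sum>l\<in>UNIV. H v $ k $ l * (partial l X v \<bullet> partial k (partial j f) v)) = \<beta> j - \<gamma> j"
    unfolding trX[symmetric]
    by (subst sum.swap) (simp add: metric_inv(2)[OF v] partial2_commute[OF v, of j])
  have "(\<Sum>k\<in>UNIV. \<Sum>l\<in>UNIV. H v $ k $ l * darboux f y j k l v)
    = - ((\<Sum>k\<in>UNIV. \<Sum>l\<in>UNIV. H v $ k $ l * partial j (\<lambda>v. G v $ k $ l) v)
        + (\<Sum>k\<in>UNIV. \<Sum>l\<in>UNIV. H v $ k $ l * (partial k X v \<bullet> partial j (partial l f) v))
        + (\<Sum>k\<in>UNIV. \<Sum>l\<in>UNIV. H v $ k $ l * (partial l X v \<bullet> partial k (partial j f) v))) / 2"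
  proof -
    have "partial l (partial k (partial j f)) v = partial j (partial l (partial k f)) v" for k l
      using partial3_commute[OF v] by metis
    then have "H v $ k $ l * darboux f y j k l v = - (H v $ k $ l * partial j (\<lambda>v. G v $ k $ l) v
        + H v $ k $ l * (partial k X v \<bullet> partial j (partial l f) v)
        + H v $ k $ l * (partial l X v \<bullet> partial k (partial j f) v)) / 2" for k l
      unfolding darboux_eq[OF v] partial_metric[OF v]
      by (simp add: algebra_simps partial2_commute[OF v, of k l])
    then show ?thesis
      by (simp only: sum.distrib sum_negf sum_divide_distrib[symmetric])
  qed
  moreover have "(\<Sum>k\<in>UNIV. \<Sum>l\<in>UNIV. H v $ k $ l * partial j (\<lambda>v. G v $ k $ l) v) = 2 * \<gamma> j - 2 * \<beta> j"
    unfolding trG[symmetric] by (simp only: metric_inv(2)[OF v, of _ _])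
  ultimately show ?thesis unfolding trX trX' by simp
qed

end

lemma det_scaleR: "det (c *\<^sub>R (M :: real^'n^'n)) = c ^ CARD('n) * det M"
  by (simp add: det_def sum_distrib_left mult_ac prod.distrib)

lemma local_pick_rescale:
  fixes f y y\<^sub>0 :: "real^'n::finite \<Rightarrow> real^'m::finite"
  assumes y\<^sub>0: "local_nondegenerate S f y\<^sub>0" and y: "local_nondegenerate S f y" and v: "v \<in> S"
    and vol: "\<And>v. v \<in> S \<Longrightarrow> det (relative_metric f y\<^sub>0 v) * (covector f y\<^sub>0 v \<bullet> covector f y\<^sub>0 v) = det (first_form f v)"
    and \<rho>: "\<And>v. v \<in> S \<Longrightarrow> covector f y v = \<rho> v *\<^sub>R covector f y\<^sub>0 v" "\<rho> differentiable (at v)" "\<rho> v > 0"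
  shows "local_pick f y v = 1 / \<rho> v * (local_pick f y\<^sub>0 v
    + 3 * (real CARD('n) + 2) / (4 * (\<rho> v)\<^sup>2 * real CARD('n) * (real CARD('n) - 1)) *
      (\<Sum>j\<in>UNIV. \<Sum>k\<in>UNIV. matrix_inv (relative_metric f y\<^sub>0 v) $ j $ k * partial j \<rho> v * partial k \<rho> v))"
proof -
  interpret n0: local_nondegenerate S f y\<^sub>0 by (rule y\<^sub>0)
  interpret n1: local_nondegenerate S f y by (rule y)
  define t where "t j = - partial j \<rho> v / (2 * \<rho> v)" for j
  have alg: "(1 / r * (c + a * (1 / (4 * r\<^sup>2) * q))) / (n * m) = 1 / r * (c / (n * m) + a / (4 * r\<^sup>2 * n * m) * q)"
    for r c a q n m :: real
    by (simp add: add_divide_distrib distrib_left mult_ac)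
  have G: "n1.G w $ i $ j = \<rho> w * n0.G w $ i $ j" if "w \<in> S" for w i j
    by (simp add: n0.metric_nth n1.metric_nth \<rho>(1)[OF that])
  have dG: "partial l (\<lambda>w. n1.G w $ i $ j) v = \<rho> v * partial l (\<lambda>w. n0.G w $ i $ j) v + partial l \<rho> v * n0.G v $ i $ j" for l i j
  proof -
    have "partial l (\<lambda>w. n1.G w $ i $ j) v = partial l (\<lambda>w. \<rho> w * n0.G w $ i $ j) v"
      by (rule partial_transform[OF n0.open_S v]) (simp_all add: G \<rho>(2) n0.metric_differentiable v)
    then show ?thesis by (simp add: partial_mult \<rho>(2) n0.metric_differentiable v)
  qed
  have "n1.G v = \<rho> v *\<^sub>R n0.G v"
    by (simp add: vec_eq_iff G[OF v])
  then have "((1 / \<rho> v) *\<^sub>R n0.H v) ** n1.G v = n0.H v ** n0.G v"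
    using \<rho>(3) by (simp add: matrix_matrix_mult_def)
  also have "\<dots> = mat 1"
    by (rule matrix_inv_inverse(2)[OF n0.metric_nonsingular[OF v]])
  finally have "((1 / \<rho> v) *\<^sub>R n0.H v) ** n1.G v = mat 1" .
  then have H: "n1.H v = (1 / \<rho> v) *\<^sub>R n0.H v"
    by (rule matrix_inv_unique)
  have A: "darboux f y j k l v = \<rho> v * (darboux f y\<^sub>0 j k l v + sym_product t (n0.G v) j k l)" for j k l
    unfolding n0.darboux_metric[OF v] n1.darboux_metric[OF v] dG \<rho>(1)[OF v] sym_product_def t_def
    using \<rho>(3) by (simp add: field_simps)
  have "contract3 (n1.H v) (\<lambda>j k l. darboux f y j k l v) (\<lambda>j k l. darboux f y j k l v)
    = 1 / \<rho> v * contract3 (n0.H v) (\<lambda>j k l. darboux f y\<^sub>0 j k l v + sym_product t (n0.G v) j k l)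
        (\<lambda>j k l. darboux f y\<^sub>0 j k l v + sym_product t (n0.G v) j k l)"
    unfolding H A contract3_scale using \<rho>(3) by (simp add: power2_eq_square power3_eq_cube)
  also have "\<dots> = 1 / \<rho> v * (contract3 (n0.H v) (\<lambda>j k l. darboux f y\<^sub>0 j k l v) (\<lambda>j k l. darboux f y\<^sub>0 j k l v)
      + 3 * (real CARD('n) + 2) * (\<Sum>j\<in>UNIV. \<Sum>k\<in>UNIV. n0.H v $ j $ k * t j * t k))"
    by (subst contract3_add_sym_product)
      (use n0.metric_inv[OF v] n0.metric_sym[OF v] n0.darboux_sym[OF v] n0.darboux_trace[OF v vol] in blast)+
  also have "(\<Sum>j\<in>UNIV. \<Sum>k\<in>UNIV. n0.H v $ j $ k * t j * t k)
    = 1 / (4 * (\<rho> v)\<^sup>2) * (\<Sum>j\<in>UNIV. \<Sum>k\<in>UNIV. n0.H v $ j $ k * partial j \<rho> v * partial k \<rho> v)"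
    unfolding sum_distrib_left t_def by (intro sum.cong refl) (simp add: power2_eq_square)
  finally show ?thesis
    unfolding n0.local_pick_contract3 n1.local_pick_contract3
    by (simp only: alg)
qed

lemma matrix_inv_positive_definite:
  fixes M :: "real^'n^'n"
  assumes pos: "\<And>w. w \<noteq> 0 \<Longrightarrow> w \<bullet> (M *v w) > 0"
  shows "det M \<noteq> 0" and "w \<noteq> 0 \<Longrightarrow> w \<bullet> (matrix_inv M *v w) > 0"
proof -
  have "w = 0" if "M *v w = 0" for w
    using pos[of w] that by fastforce
  then have "\<exists>B. B ** M = mat 1"
    unfolding matrix_left_invertible_ker by blast
  then show nz: "det M \<noteq> 0"
    unfolding invertible_left_inverse[symmetric] invertible_det_nz .
  assume w: "w \<noteq> 0"
  have Mw: "M *v (matrix_inv M *v w) = w"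
    by (simp add: matrix_vector_mul_assoc matrix_inv_inverse[OF nz])
  then have "matrix_inv M *v w \<noteq> 0" using w by auto
  from pos[OF this] show "w \<bullet> (matrix_inv M *v w) > 0"
    unfolding Mw by (simp add: inner_commute)
qed

lemma inner_matrix_vector_eq_sum:
  fixes M :: "real^'n^'n"
  shows "w \<bullet> (M *v w) = (\<Sum>j\<in>UNIV. \<Sum>k\<in>UNIV. M $ j $ k * w $ j * w $ k)"
  by (simp add: inner_vec_def matrix_vector_mult_def sum_distrib_left mult_ac)

section \<open>Change of coordinates\<close>

lemma det_congruence:
  fixes J M M' :: "real^'n^'n"
  assumes "\<And>i j. M $ i $ j = (\<Sum>a\<in>UNIV. \<Sum>b\<in>UNIV. J $ a $ i * J $ b $ j * M' $ a $ b)"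
  shows "det M = (det J)\<^sup>2 * det M'"
proof -
  have "M = transpose J ** (M' ** J)"
    by (simp add: vec_eq_iff assms matrix_matrix_mult_def transpose_def sum_distrib_left mult_ac)
  then show ?thesis by (simp add: det_mul power2_eq_square)
qed

text \<open>In this form the second fundamental form transforms under a change of coordinates without second
  derivatives of the transition map.\<close>

lemma second_form_weingarten:
  fixes f N :: "real^'n::finite \<Rightarrow> real^'m::finite"
  assumes S: "open S" "u \<in> S" and f: "partial i f differentiable (at u)" and N: "N differentiable (at u)"
    and orth: "\<And>v. v \<in> S \<Longrightarrow> N v \<bullet> partial i f v = 0"
  shows "second_form N f u $ i $ j = - (partial j N u \<bullet> partial i f u)"
proof -
  have "partial j (\<lambda>v. N v \<bullet> partial i f v) u = partial j (\<lambda>v. 0 :: real) u"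
    by (rule partial_transform[OF S]) (simp_all add: orth)
  then show ?thesis
    by (simp add: second_form_def partial_inner f N)
qed

lemma local_gauss_curvature_change:
  fixes f f' N N' :: "real^'n::finite \<Rightarrow> real^'m::finite" and \<tau> :: "real^'n \<Rightarrow> real^'n"
  assumes S: "open S" "u \<in> S" and S': "open S'" "\<tau> u \<in> S'"
    and \<tau>: "\<tau> differentiable (at u)" "det (matrix (frechet_derivative \<tau> (at u))) \<noteq> 0"
    and f: "f differentiable (at u)" "\<And>i. partial i f differentiable (at u)" "N differentiable (at u)"
      "\<And>v i. v \<in> S \<Longrightarrow> N v \<bullet> partial i f v = 0"
    and f': "f' differentiable (at (\<tau> u))" "\<And>i. partial i f' differentiable (at (\<tau> u))" "N' differentiable (at (\<tau> u))"
      "\<And>v i. v \<in> S' \<Longrightarrow> N' v \<bullet> partial i f' v = 0"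
    and W: "open W" "u \<in> W" "\<And>v. v \<in> W \<Longrightarrow> f v = f' (\<tau> v)" "\<And>v. v \<in> W \<Longrightarrow> N v = N' (\<tau> v)"
  shows "local_gauss_curvature N f u = local_gauss_curvature N' f' (\<tau> u)"
proof -
  let ?J = "matrix (frechet_derivative \<tau> (at u))"
  have J: "?J $ a $ i = partial i \<tau> u $ a" for a i
    by (simp add: matrix_def partial_def)
  have pf: "partial i f u = (\<Sum>a\<in>UNIV. ?J $ a $ i *\<^sub>R partial a f' (\<tau> u))" for i
  proof -
    have "partial i (\<lambda>v. f' (\<tau> v)) u = partial i f u"
      by (rule partial_transform[OF W(1,2) f(1) W(3)])
    then show ?thesis unfolding partial_compose[OF \<tau>(1) f'(1)] J by simp
  qed
  have pN: "partial i N u = (\<Sum>a\<in>UNIV. ?J $ a $ i *\<^sub>R partial a N' (\<tau> u))" for i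
  proof -
    have "partial i (\<lambda>v. N' (\<tau> v)) u = partial i N u"
      by (rule partial_transform[OF W(1,2) f(3) W(4)])
    then show ?thesis unfolding partial_compose[OF \<tau>(1) f'(3)] J by simp
  qed
  have "det (first_form f u) = (det ?J)\<^sup>2 * det (first_form f' (\<tau> u))"
  proof (rule det_congruence)
    show "first_form f u $ i $ j = (\<Sum>a\<in>UNIV. \<Sum>b\<in>UNIV. ?J $ a $ i * ?J $ b $ j * first_form f' (\<tau> u) $ a $ b)" for i j
      unfolding first_form_def vec_lambda_beta pf inner_sum_left
      unfolding inner_sum_right by (simp add: mult_ac)
  qed
  moreover have "det (second_form N f u) = (det ?J)\<^sup>2 * det (second_form N' f' (\<tau> u))"
  proof (rule det_congruence)
    fix i j
    have h': "second_form N' f' (\<tau> u) $ a $ b = - (partial b N' (\<tau> u) \<bullet> partial a f' (\<tau> u))" for a b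
      by (rule second_form_weingarten[OF S' f'(2,3,4)])
    have "second_form N f u $ i $ j = - (partial j N u \<bullet> partial i f u)"
      by (rule second_form_weingarten[OF S f(2,3,4)])
    also have "\<dots> = (\<Sum>a\<in>UNIV. \<Sum>b\<in>UNIV. ?J $ a $ i * ?J $ b $ j * - (partial b N' (\<tau> u) \<bullet> partial a f' (\<tau> u)))"
      unfolding pN pf inner_sum_right
      by (simp add: inner_sum_left sum_distrib_left sum_negf mult_ac)
    also have "\<dots> = (\<Sum>a\<in>UNIV. \<Sum>b\<in>UNIV. ?J $ a $ i * ?J $ b $ j * second_form N' f' (\<tau> u) $ a $ b)"
      by (simp only: h')
    finally show "second_form N f u $ i $ j = \<dots>" .
  qed
  ultimately show ?thesis
    using \<tau>(2) by (simp add: local_gauss_curvature_def)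
qed

section \<open>Charts\<close>

lemma Ck_on_Suc: "Ck_on (Suc k) f S \<Longrightarrow> Ck_on k f S"
proof (induction k arbitrary: f)
  case 0
  then show ?case
    by (auto intro!: continuous_at_imp_continuous_on differentiable_imp_continuous_within)
next
  case (Suc k)
  then have "\<forall>u\<in>S. f differentiable at u" "\<And>v. Ck_on (Suc k) (\<lambda>u. frechet_derivative f (at u) v) S"
    unfolding Ck_on.simps(2)[of "Suc k"] by blast+
  with Suc.IH show ?case unfolding Ck_on.simps(2)[of k f] by blast
qed

lemma Ck_on_le: "k \<le> l \<Longrightarrow> Ck_on l f S \<Longrightarrow> Ck_on k f S"
  by (induction l rule: dec_induct) (blast intro: Ck_on_Suc)+

lemma connected_space_locally_constant:
  assumes T: "connected_space T"
    and loc: "\<And>p. p \<in> topspace T \<Longrightarrow> \<exists>U. openin T U \<and> p \<in> U \<and> (\<forall>p'\<in>U. f p' = f p)"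
    and p: "p \<in> topspace T" and p': "p' \<in> topspace T"
  shows "f p' = f p"
proof -
  have o: "openin T {a \<in> topspace T. P (f a)}" for P
  proof (rule openin_subopen[THEN iffD2], intro ballI)
    fix a assume a: "a \<in> {a \<in> topspace T. P (f a)}"
    then obtain U where U: "openin T U" "a \<in> U" "\<forall>b\<in>U. f b = f a" using loc[of a] by auto
    have "U \<subseteq> {a \<in> topspace T. P (f a)}"
      using openin_subset[OF U(1)] U(3) a by auto
    with U(1,2) show "\<exists>U. openin T U \<and> a \<in> U \<and> U \<subseteq> {a \<in> topspace T. P (f a)}"
      by (intro exI[of _ U] conjI)
  qed
  let ?E = "{a \<in> topspace T. f a = f p}"
  have "topspace T - ?E = {a \<in> topspace T. f a \<noteq> f p}" by auto
  then have "closedin T ?E"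
    using o[of "\<lambda>z. z \<noteq> f p"] by (simp add: closedin_def)
  with T o[of "\<lambda>z. z = f p"] have "?E = {} \<or> ?E = topspace T"
    by (intro connected_space_clopen_in[THEN iffD1, rule_format] conjI)
  moreover have "p \<in> ?E" using p by simp
  ultimately have "?E = topspace T" by blast
  then have "p' \<in> ?E" using p' by simp
  then show ?thesis by simp
qed

lemma chart_props:
  assumes "is_chart T c"
  shows "chart_dom c \<subseteq> topspace T" "open (chart_img c)" "inj_on (snd c) (chart_dom c)"
    "p \<in> chart_dom c \<Longrightarrow> in_chart c f (snd c p) = f p"
    "open U \<Longrightarrow> openin T {p \<in> chart_dom c. snd c p \<in> U}"
    "openin T V \<Longrightarrow> open (snd c ` (chart_dom c \<inter> V))"
proof -
  have o: "openin T (chart_dom c)" and oi: "open (chart_img c)"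
    and h: "homeomorphic_map (subtopology T (chart_dom c)) (top_of_set (chart_img c)) (snd c)"
    using assms unfolding is_chart_def by blast+
  show d: "chart_dom c \<subseteq> topspace T" using o by (rule openin_subset)
  then have ts: "topspace (subtopology T (chart_dom c)) = chart_dom c" by (simp only: topspace_subtopology Int_absorb1)
  show "open (chart_img c)" by (rule oi)
  show inj: "inj_on (snd c) (chart_dom c)"
    using homeomorphic_imp_injective_map[OF h] unfolding ts .
  show "in_chart c f (snd c p) = f p" if "p \<in> chart_dom c"
    unfolding in_chart_def o_def inv_into_f_f[OF inj that] ..
  show "openin T {p \<in> chart_dom c. snd c p \<in> U}" if "open U"
  proof -
    have cont: "continuous_map (subtopology T (chart_dom c)) euclidean (snd c)"
      by (rule continuous_map_into_fulltopology[OF homeomorphic_imp_continuous_map[OF h]])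
    have "openin euclidean U" using that by (simp only: open_openin)
    from openin_continuous_map_preimage[OF cont this]
    have "openin (subtopology T (chart_dom c)) {p \<in> chart_dom c. snd c p \<in> U}"
      unfolding ts .
    then show ?thesis by (rule openin_open_subtopology[OF o, THEN iffD1, THEN conjunct1])
  qed
  show "open (snd c ` (chart_dom c \<inter> V))" if "openin T V"
  proof -
    have "openin (subtopology T (chart_dom c)) (chart_dom c \<inter> V)"
      unfolding openin_subtopology using that by blast
    then have "openin (top_of_set (chart_img c)) (snd c ` (chart_dom c \<inter> V))"
      by (rule homeomorphic_map_openness_eq[OF h, THEN iffD1, THEN conjunct2])
    then show ?thesis by (rule openin_open_eq[OF oi, THEN iffD1, THEN conjunct1])
  qed
qed

locale normalized_hypersurface =
  fixes T :: "'p topology" and A :: "('p, 'n::finite) chart set"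
    and x \<xi> y :: "'p \<Rightarrow> real^'m::finite" and r s :: nat
  assumes hyp: "hypersurface r T A x \<xi>" and r: "r \<ge> 4" and s: "s \<ge> 1"
    and pos: "positive_definite_II A x \<xi>"
    and y: "relative_normalization s A x y"
    and support_pos: "\<And>p. p \<in> topspace T \<Longrightarrow> support \<xi> y p > 0"
begin

lemma chart: "c \<in> A \<Longrightarrow> is_chart T c"
  using hyp by (auto simp: hypersurface_def connected_oriented_manifold_def oriented_atlas_def)

lemma chart_at:
  assumes "p \<in> topspace T"
  shows "chart_at A p \<in> A" "p \<in> chart_dom (chart_at A p)"
proof -
  have "\<exists>c. c \<in> A \<and> p \<in> chart_dom c"
    using assms hyp unfolding hypersurface_def connected_oriented_manifold_def oriented_atlas_def by blast
  from someI_ex[OF this] show "chart_at A p \<in> A" "p \<in> chart_dom (chart_at A p)"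
    unfolding chart_at_def by auto
qed

lemma transition:
  assumes "c \<in> A" "d \<in> A" "p \<in> chart_dom c" "p \<in> chart_dom d"
  shows "in_chart c (snd d) differentiable (at (snd c p))"
    and "det (matrix (frechet_derivative (in_chart c (snd d)) (at (snd c p)))) \<noteq> 0"
proof -
  let ?W = "snd c ` (chart_dom c \<inter> chart_dom d)"
  have *: "Ck_on r (in_chart c (snd d)) ?W"
    "\<forall>u\<in>?W. det (matrix (frechet_derivative (in_chart c (snd d)) (at u))) > 0"
    using assms(1,2) hyp
    unfolding hypersurface_def connected_oriented_manifold_def oriented_atlas_def Let_def by auto
  have p: "snd c p \<in> ?W" using assms by blast
  show "det (matrix (frechet_derivative (in_chart c (snd d)) (at (snd c p)))) \<noteq> 0"
    using bspec[OF *(2) p] by simp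
  have "Ck_on (Suc 0) (in_chart c (snd d)) ?W"
    by (rule Ck_on_le[OF _ *(1)]) (use r in simp)
  then show "in_chart c (snd d) differentiable (at (snd c p))"
    using p unfolding Ck_on.simps by blast
qed

lemma in_chart_transition:
  assumes "c \<in> A" "d \<in> A" "u \<in> snd c ` (chart_dom c \<inter> chart_dom d)"
  shows "in_chart c h u = in_chart d h (in_chart c (snd d) u)"
proof -
  obtain p where p: "u = snd c p" "p \<in> chart_dom c" "p \<in> chart_dom d" using assms(3) by blast
  show ?thesis
    unfolding p(1) chart_props(4)[OF chart[OF assms(1)] p(2)] chart_props(4)[OF chart[OF assms(2)] p(3)] ..
qed

lemma local_normalization:
  assumes c: "c \<in> A"
  shows "local_normalization (chart_img c) (in_chart c x) (in_chart c y)"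
proof
  show "open (chart_img c)" by (rule chart_props[OF chart[OF c]])
  show "CARD('m) = CARD('n) + 1" using hyp by (simp add: hypersurface_def)
  have "Ck_on r (in_chart c x) (chart_img c)"
    using hyp c by (auto simp: hypersurface_def immersion_def Ck_map_def)
  then show "Ck_on 4 (in_chart c x) (chart_img c)"
    by (rule Ck_on_le[OF r])
  have "Ck_on s (in_chart c y) (chart_img c)"
    using y c by (auto simp: relative_normalization_def Ck_map_def)
  then have "Ck_on (Suc 0) (in_chart c y) (chart_img c)"
    using s by (intro Ck_on_le[of "Suc 0" s]) auto
  then show "in_chart c y differentiable (at v)" if "v \<in> chart_img c" for v
    using that unfolding Ck_on.simps by blast
qed (use y c in \<open>auto simp: relative_normalization_def Let_def\<close>)

abbreviation "N c \<equiv> in_chart c \<xi>"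
abbreviation "q c \<equiv> in_chart c (support \<xi> y)"

lemma normal:
  assumes c: "c \<in> A" and u: "u \<in> chart_img c"
  shows "N c u \<bullet> partial i (in_chart c x) u = 0" "N c u \<bullet> N c u = 1"
    "q c u = N c u \<bullet> in_chart c y u" "q c u > 0"
proof -
  have n: "unit_normal_field T A x \<xi>" using hyp by (simp add: hypersurface_def)
  then show "N c u \<bullet> partial i (in_chart c x) u = 0"
    using c u by (auto simp: unit_normal_field_def)
  obtain p where p: "p \<in> chart_dom c" "u = snd c p" using u by blast
  then have "p \<in> topspace T" using chart_props(1)[OF chart[OF c]] by blast
  note e = chart_props(4)[OF chart[OF c] p(1)]
  show "N c u \<bullet> N c u = 1" "q c u = N c u \<bullet> in_chart c y u" "q c u > 0"
    using n support_pos[OF \<open>p \<in> topspace T\<close>] \<open>p \<in> topspace T\<close> unfolding p(2) e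
    by (simp_all add: unit_normal_field_def support_def dot_square_norm)
qed

lemma covector_normal:
  assumes c: "c \<in> A" and u: "u \<in> chart_img c"
  shows "covector (in_chart c x) (in_chart c y) u = (1 / q c u) *\<^sub>R N c u"
proof -
  interpret local_normalization "chart_img c" "in_chart c x" "in_chart c y" by (rule local_normalization[OF c])
  show ?thesis
    by (rule covector_unique[OF u]) (use normal[OF c u] in simp_all)
qed

lemma covector_square:
  assumes c: "c \<in> A" and u: "u \<in> chart_img c"
  shows "covector (in_chart c x) (in_chart c y) u \<bullet> covector (in_chart c x) (in_chart c y) u = (1 / q c u)\<^sup>2"
  unfolding covector_normal[OF assms] by (simp add: normal(2)[OF assms] power2_eq_square)

lemma relative_metric_eq:
  assumes c: "c \<in> A" and u: "u \<in> chart_img c"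
  shows "relative_metric (in_chart c x) (in_chart c y) u = (1 / q c u) *\<^sub>R second_form (N c) (in_chart c x) u"
  by (simp add: relative_metric_def second_form_def covector_normal[OF c u] vec_eq_iff)

lemma relative_metric_pos:
  assumes c: "c \<in> A" and u: "u \<in> chart_img c" and w: "w \<noteq> 0"
  shows "w \<bullet> (relative_metric (in_chart c x) (in_chart c y) u *v w) > 0"
proof -
  have "w \<bullet> (second_form (N c) (in_chart c x) u *v w) > 0"
    using pos c u w by (auto simp: positive_definite_II_def)
  then show ?thesis
    unfolding relative_metric_eq[OF c u] scaleR_matrix_vector_assoc[symmetric]
    using normal(4)[OF c u] by simp
qed

lemma local_nondegenerate:
  assumes c: "c \<in> A"
  shows "local_nondegenerate (chart_img c) (in_chart c x) (in_chart c y)"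
  unfolding local_nondegenerate_def local_nondegenerate_axioms_def
  using local_normalization[OF c] matrix_inv_positive_definite(1)[OF relative_metric_pos[OF c]] by blast

lemma normal_differentiable:
  assumes c: "c \<in> A" and u: "u \<in> chart_img c"
  shows "N c differentiable (at u)"
proof -
  interpret local_normalization "chart_img c" "in_chart c x" "in_chart c y" by (rule local_normalization[OF c])
  have "X u \<noteq> 0" using covector(3)[OF u] by auto
  then have "(\<lambda>v. norm (X v)) differentiable (at u)"
    using differentiable_compose[OF differentiable_norm_at covector_differentiable[OF u]] by (simp add: o_def)
  then have "(\<lambda>v. (1 / norm (X v)) *\<^sub>R X v) differentiable (at u)"
    using \<open>X u \<noteq> 0\<close> by (intro differentiable_scaleR differentiable_divide covector_differentiable u) auto
  then show ?thesis
  proof (rule differentiable_transform_open[OF open_S u])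
    fix v assume v: "v \<in> chart_img c"
    have "norm (N c v) = 1" using normal(2)[OF c v] by (simp add: norm_eq_sqrt_inner)
    then show "(1 / norm (X v)) *\<^sub>R X v = N c v"
      using normal(4)[OF c v] by (simp add: covector_normal[OF c v])
  qed
qed

lemma gauss_curvature_chart:
  assumes c: "c \<in> A" and p: "p \<in> chart_dom c"
  shows "gauss_curvature A x \<xi> p = local_gauss_curvature (N c) (in_chart c x) (snd c p)"
proof -
  define d where "d = chart_at A p"
  have "p \<in> topspace T" using p chart_props(1)[OF chart[OF c]] by blast
  then have d: "d \<in> A" "p \<in> chart_dom d" unfolding d_def by (auto intro: chart_at)
  let ?W = "snd c ` (chart_dom c \<inter> chart_dom d)"
  interpret lc: local_normalization "chart_img c" "in_chart c x" "in_chart c y" by (rule local_normalization[OF c])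
  interpret ld: local_normalization "chart_img d" "in_chart d x" "in_chart d y" by (rule local_normalization[OF d(1)])
  have \<tau>: "in_chart c (snd d) (snd c p) = snd d p"
    by (rule chart_props(4)[OF chart[OF c] p])
  have pc: "snd c p \<in> chart_img c" and pd: "snd d p \<in> chart_img d" and pW: "snd c p \<in> ?W" using p d by auto
  have oW: "open ?W"
    using chart_props(6)[OF chart[OF c]] chart[OF d(1)] by (simp add: is_chart_def)
  have "local_gauss_curvature (N c) (in_chart c x) (snd c p) =
    local_gauss_curvature (N d) (in_chart d x) (in_chart c (snd d) (snd c p))"
    by (rule local_gauss_curvature_change[OF lc.open_S pc ld.open_S pd[folded \<tau>] transition[OF c d(1) p d(2)]
          lc.f_differentiable(1)[OF pc] lc.f_differentiable(2)[OF pc] normal_differentiable[OF c pc] normal(1)[OF c]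
          ld.f_differentiable(1)[OF pd, folded \<tau>] ld.f_differentiable(2)[OF pd, folded \<tau>]
          normal_differentiable[OF d(1) pd, folded \<tau>] normal(1)[OF d(1)]
          oW pW in_chart_transition[OF c d(1)] in_chart_transition[OF c d(1)]])
  then show ?thesis
    unfolding gauss_curvature_def Let_def d_def[symmetric] \<tau> by simp
qed

end

section \<open>Comparison with the equiaffine normalization\<close>

locale affine_comparison =
  rel: normalized_hypersurface T A x \<xi> y r s + aff: normalized_hypersurface T A x \<xi> y\<^sub>0 r s\<^sub>0
  for T :: "'p topology" and A :: "('p, 'n::finite) chart set"
    and x \<xi> y y\<^sub>0 :: "'p \<Rightarrow> real^'m::finite" and r s s\<^sub>0 :: nat +
  assumes n: "CARD('n) \<ge> 2"
    and support_aff: "\<And>p. p \<in> topspace T \<Longrightarrow> support \<xi> y\<^sub>0 p ^ (CARD('n) + 2) = gauss_curvature A x \<xi> p"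
begin

definition ratio :: "'p \<Rightarrow> real" where
  "ratio p = support \<xi> y\<^sub>0 p / support \<xi> y p"

lemma in_chart_ratio: "in_chart c ratio u = aff.q c u / rel.q c u"
  by (simp add: in_chart_def ratio_def)

lemma ratio_pos: "c \<in> A \<Longrightarrow> u \<in> chart_img c \<Longrightarrow> in_chart c ratio u > 0"
  using rel.normal(4) aff.normal(4) by (simp add: in_chart_ratio)

lemma covector_ratio:
  assumes "c \<in> A" "u \<in> chart_img c"
  shows "covector (in_chart c x) (in_chart c y) u = in_chart c ratio u *\<^sub>R covector (in_chart c x) (in_chart c y\<^sub>0) u"
  unfolding rel.covector_normal[OF assms] aff.covector_normal[OF assms]
  using aff.normal(4)[OF assms] by (simp add: in_chart_ratio)

lemma ratio_differentiable:
  assumes c: "c \<in> A" and u: "u \<in> chart_img c"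
  shows "in_chart c ratio differentiable (at u)"
proof -
  interpret n: local_normalization "chart_img c" "in_chart c x" "in_chart c y" by (rule rel.local_normalization[OF c])
  interpret n0: local_normalization "chart_img c" "in_chart c x" "in_chart c y\<^sub>0" by (rule aff.local_normalization[OF c])
  have "(\<lambda>u. (n.X u \<bullet> n0.X u) / (n0.X u \<bullet> n0.X u)) differentiable (at u)"
    using n0.covector(3)[OF u]
    by (intro differentiable_divide differentiable_inner n.covector_differentiable n0.covector_differentiable u) auto
  then show ?thesis
  proof (rule differentiable_transform_open[OF n.open_S u])
    fix v assume v: "v \<in> chart_img c"
    show "(n.X v \<bullet> n0.X v) / (n0.X v \<bullet> n0.X v) = in_chart c ratio v"
      unfolding covector_ratio[OF c v] using n0.covector(3)[OF v] by simp
  qed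
qed

lemma volume:
  assumes c: "c \<in> A" and u: "u \<in> chart_img c"
  shows "det (relative_metric (in_chart c x) (in_chart c y\<^sub>0) u) *
    (covector (in_chart c x) (in_chart c y\<^sub>0) u \<bullet> covector (in_chart c x) (in_chart c y\<^sub>0) u) = det (first_form (in_chart c x) u)"
proof -
  interpret n0: local_normalization "chart_img c" "in_chart c x" "in_chart c y\<^sub>0" by (rule aff.local_normalization[OF c])
  obtain p where p: "p \<in> chart_dom c" "u = snd c p" using u by blast
  then have "p \<in> topspace T" using chart_props(1)[OF rel.chart[OF c]] by blast
  have "aff.q c u = support \<xi> y\<^sub>0 p"
    unfolding p(2) by (rule chart_props(4)[OF rel.chart[OF c] p(1)])
  then have "aff.q c u ^ (CARD('n) + 2) = det (second_form (rel.N c) (in_chart c x) u) / det (first_form (in_chart c x) u)"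
    using support_aff[OF \<open>p \<in> topspace T\<close>] unfolding rel.gauss_curvature_chart[OF c p(1)] p(2)[symmetric]
    by (simp only: local_gauss_curvature_def)
  then have "det (second_form (rel.N c) (in_chart c x) u) = aff.q c u ^ (CARD('n) + 2) * det (first_form (in_chart c x) u)"
    by (rule nonzero_eq_divide_eq[OF n0.gram_nonsingular[OF u], THEN iffD1, symmetric])
  then show ?thesis
    unfolding aff.relative_metric_eq[OF c u] det_scaleR aff.covector_square[OF c u]
    using aff.normal(4)[OF c u] by (simp add: power_add power_one_over power2_eq_square)
qed

lemma pick_difference:
  assumes p: "p \<in> topspace T"
  defines "c \<equiv> chart_at A p"
  shows "pick_invariant A x y p / support \<xi> y p - pick_invariant A x y\<^sub>0 p / support \<xi> y\<^sub>0 p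
    = 3 * (real CARD('n) + 2) / (4 * (ratio p)\<^sup>2 * real CARD('n) * (real CARD('n) - 1)) / support \<xi> y\<^sub>0 p *
      ((\<chi> j. partial j (in_chart c ratio) (snd c p)) \<bullet>
        (matrix_inv (relative_metric (in_chart c x) (in_chart c y\<^sub>0) (snd c p)) *v (\<chi> j. partial j (in_chart c ratio) (snd c p))))"
    (is "?l = ?k / _ * ?Q")
proof -
  have c: "c \<in> A" "p \<in> chart_dom c" unfolding c_def by (rule rel.chart_at[OF p])+
  then have u: "snd c p \<in> chart_img c" by blast
  have rp: "in_chart c ratio (snd c p) = ratio p"
    by (rule chart_props(4)[OF rel.chart[OF c(1)] c(2)])
  have "pick_invariant A x y p = 1 / ratio p * (pick_invariant A x y\<^sub>0 p + ?k * ?Q)"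
    unfolding pick_invariant_def Let_def c_def[symmetric] inner_matrix_vector_eq_sum vec_lambda_beta rp[symmetric]
    by (rule local_pick_rescale[OF aff.local_nondegenerate[OF c(1)] rel.local_nondegenerate[OF c(1)] u volume[OF c(1)]
          covector_ratio[OF c(1)] ratio_differentiable[OF c(1) u] ratio_pos[OF c(1) u]])
  moreover have "1 / (b / a) * (j + k * z) / a - j / b = k / b * z" if "a > 0" "b > 0" for a b j k z :: real
    using that by (simp add: field_simps)
  ultimately show ?thesis
    using rel.support_pos[OF p] aff.support_pos[OF p] unfolding ratio_def[of p] by presburger
qed

lemma difference_factor_pos:
  assumes "p \<in> topspace T"
  shows "3 * (real CARD('n) + 2) / (4 * (ratio p)\<^sup>2 * real CARD('n) * (real CARD('n) - 1)) / support \<xi> y\<^sub>0 p > 0"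
proof -
  have "ratio p > 0" using rel.support_pos[OF assms] aff.support_pos[OF assms] by (simp add: ratio_def)
  then show ?thesis using aff.support_pos[OF assms] n by simp
qed

lemma inverse_metric_pos:
  assumes "p \<in> topspace T" "w \<noteq> 0"
  shows "w \<bullet> (matrix_inv (relative_metric (in_chart (chart_at A p) x) (in_chart (chart_at A p) y\<^sub>0) (snd (chart_at A p) p)) *v w) > 0"
  using rel.chart_at[OF assms(1)] assms(2)
  by (intro matrix_inv_positive_definite(2) aff.relative_metric_pos) auto

lemma pick_difference_nonneg:
  assumes p: "p \<in> topspace T"
  shows "pick_invariant A x y p / support \<xi> y p - pick_invariant A x y\<^sub>0 p / support \<xi> y\<^sub>0 p \<ge> 0"
proof -
  have "w \<bullet> (matrix_inv (relative_metric (in_chart (chart_at A p) x) (in_chart (chart_at A p) y\<^sub>0) (snd (chart_at A p) p)) *v w) \<ge> 0" for w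
    using inverse_metric_pos[OF p, of w] by (cases "w = 0") auto
  then show ?thesis
    unfolding pick_difference[OF p] using difference_factor_pos[OF p]
    by (intro mult_nonneg_nonneg) auto
qed

lemma pick_difference_eq_0_iff:
  assumes p: "p \<in> topspace T"
  shows "pick_invariant A x y p / support \<xi> y p - pick_invariant A x y\<^sub>0 p / support \<xi> y\<^sub>0 p = 0
    \<longleftrightarrow> (\<forall>j. partial j (in_chart (chart_at A p) ratio) (snd (chart_at A p) p) = 0)"
proof -
  define w where "w = (\<chi> j. partial j (in_chart (chart_at A p) ratio) (snd (chart_at A p) p))"
  have "(\<forall>j. partial j (in_chart (chart_at A p) ratio) (snd (chart_at A p) p) = 0) \<longleftrightarrow> w = 0"
    by (simp add: w_def vec_eq_iff)
  moreover have "w = 0 \<longleftrightarrow> w \<bullet> (matrix_inv (relative_metric (in_chart (chart_at A p) x) (in_chart (chart_at A p) y\<^sub>0) (snd (chart_at A p) p)) *v w) = 0"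
    using inverse_metric_pos[OF p, of w] by (cases "w = 0") auto
  ultimately show ?thesis
    unfolding pick_difference[OF p] w_def[symmetric] using difference_factor_pos[OF p]
    by (simp only: mult_eq_0_iff) linarith
qed

lemma ratio_has_derivative_0:
  assumes crit: "\<And>p j. p \<in> topspace T \<Longrightarrow> partial j (in_chart (chart_at A p) ratio) (snd (chart_at A p) p) = 0"
    and c: "c \<in> A" and u: "u \<in> chart_img c"
  shows "(in_chart c ratio has_derivative (\<lambda>_. 0)) (at u)"
proof -
  obtain p where p: "p \<in> chart_dom c" "u = snd c p" using u by blast
  then have pT: "p \<in> topspace T" using chart_props(1)[OF rel.chart[OF c]] by blast
  define d where "d = chart_at A p"
  have d: "d \<in> A" "p \<in> chart_dom d" unfolding d_def by (rule rel.chart_at[OF pT])+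
  let ?W = "snd c ` (chart_dom c \<inter> chart_dom d)"
  have \<tau>: "in_chart c (snd d) u = snd d p"
    unfolding p(2) by (rule chart_props(4)[OF rel.chart[OF c] p(1)])
  have pd: "snd d p \<in> chart_img d" and uW: "u \<in> ?W" using p d by auto
  have oW: "open ?W"
    using chart_props(6)[OF rel.chart[OF c]] rel.chart[OF d(1)] by (simp add: is_chart_def)
  have "partial i (in_chart c ratio) u = 0" for i
  proof -
    have "partial i (\<lambda>v. in_chart d ratio (in_chart c (snd d) v)) u = partial i (in_chart c ratio) u"
      by (rule partial_transform[OF oW uW ratio_differentiable[OF c u] rel.in_chart_transition[OF c d(1)]])
    also have "partial i (\<lambda>v. in_chart d ratio (in_chart c (snd d) v)) u
      = (\<Sum>a\<in>UNIV. (partial i (in_chart c (snd d)) u $ a) *\<^sub>R partial a (in_chart d ratio) (in_chart c (snd d) u))"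
      by (rule partial_compose[OF rel.transition(1)[OF c d(1) p(1) d(2), folded p(2)]
            ratio_differentiable[OF d(1) pd, folded \<tau>]])
    also have "\<dots> = 0"
      unfolding \<tau> using crit[OF pT] by (simp add: d_def)
    finally show ?thesis by simp
  qed
  then have "frechet_derivative (in_chart c ratio) (at u) = (\<lambda>_. 0)"
    by (simp add: fun_eq_iff frechet_derivative_eq_sum_partial[OF ratio_differentiable[OF c u]])
  with has_frechet_derivative[OF ratio_differentiable[OF c u]] show ?thesis by simp
qed

lemma ratio_constant:
  assumes crit: "\<And>p j. p \<in> topspace T \<Longrightarrow> partial j (in_chart (chart_at A p) ratio) (snd (chart_at A p) p) = 0"
    and p: "p \<in> topspace T" "p' \<in> topspace T"
  shows "ratio p' = ratio p"
proof (rule connected_space_locally_constant[OF _ _ p])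
  show "connected_space T"
    using rel.hyp by (simp add: hypersurface_def connected_oriented_manifold_def)
  fix a assume a: "a \<in> topspace T"
  define c where "c = chart_at A a"
  have c: "c \<in> A" "a \<in> chart_dom c" unfolding c_def by (rule rel.chart_at[OF a])+
  note ch = chart_props[OF rel.chart[OF c(1)]]
  have "snd c a \<in> chart_img c" using c by blast
  then obtain e where e: "e > 0" "ball (snd c a) e \<subseteq> chart_img c"
    using ch(2) open_contains_ball by blast
  have "\<exists>k. \<forall>v\<in>ball (snd c a) e. in_chart c ratio v = k"
  proof (rule has_derivative_zero_constant[OF convex_ball])
    fix v assume "v \<in> ball (snd c a) e"
    then have "v \<in> chart_img c" using e(2) by blast
    then have "(in_chart c ratio has_derivative (\<lambda>_. 0)) (at v)"
      by (intro ratio_has_derivative_0[OF _ c(1)]) (rule crit)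
    then show "(in_chart c ratio has_derivative (\<lambda>_. 0)) (at v within ball (snd c a) e)"
      by (rule has_derivative_at_withinI)
  qed
  then obtain k where k: "\<And>v. v \<in> ball (snd c a) e \<Longrightarrow> in_chart c ratio v = k" by blast
  show "\<exists>U. openin T U \<and> a \<in> U \<and> (\<forall>b\<in>U. ratio b = ratio a)"
  proof (intro exI conjI ballI)
    show "openin T {b \<in> chart_dom c. snd c b \<in> ball (snd c a) e}"
      by (rule ch(5)) simp
    show "a \<in> {b \<in> chart_dom c. snd c b \<in> ball (snd c a) e}"
      using c e by simp
    fix b assume "b \<in> {b \<in> chart_dom c. snd c b \<in> ball (snd c a) e}"
    then have b: "b \<in> chart_dom c" "snd c b \<in> ball (snd c a) e" by auto
    show "ratio b = ratio a"
      using k[OF b(2)] k[of "snd c a"] e(1) unfolding ch(4)[OF b(1)] ch(4)[OF c(2)] by simp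
  qed
qed

lemma ratio_critical:
  assumes const: "\<And>p. p \<in> topspace T \<Longrightarrow> ratio p = k" and p: "p \<in> topspace T"
  shows "partial j (in_chart (chart_at A p) ratio) (snd (chart_at A p) p) = 0"
proof -
  define c where "c = chart_at A p"
  have c: "c \<in> A" "p \<in> chart_dom c" unfolding c_def by (rule rel.chart_at[OF p])+
  note ch = chart_props[OF rel.chart[OF c(1)]]
  have "k = in_chart c ratio v" if v: "v \<in> chart_img c" for v
  proof -
    obtain b where b: "b \<in> chart_dom c" "v = snd c b" using v by blast
    show ?thesis unfolding b(2) ch(4)[OF b(1)] using const ch(1) b(1) by blast
  qed
  then have "partial j (in_chart c ratio) (snd c p) = partial j (\<lambda>_. k) (snd c p)"
    by (intro partial_transform[OF ch(2)]) (use c in auto)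
  then show ?thesis unfolding c_def by simp
qed

lemma proportional_iff:
  "constantly_proportional T \<xi> y y\<^sub>0 \<longleftrightarrow> (\<exists>k. \<forall>p\<in>topspace T. ratio p = k)"
proof
  assume "constantly_proportional T \<xi> y y\<^sub>0"
  then obtain k where k: "k \<noteq> 0" "\<And>p. p \<in> topspace T \<Longrightarrow> support \<xi> y p = k * support \<xi> y\<^sub>0 p"
    unfolding constantly_proportional_def by blast
  have "ratio p = 1 / k" if "p \<in> topspace T" for p
    using aff.support_pos[OF that] k(1) by (simp add: ratio_def k(2)[OF that])
  then show "\<exists>k. \<forall>p\<in>topspace T. ratio p = k" by blast
next
  assume "\<exists>k. \<forall>p\<in>topspace T. ratio p = k"
  then obtain k where k: "\<And>p. p \<in> topspace T \<Longrightarrow> ratio p = k" by blast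
  show "constantly_proportional T \<xi> y y\<^sub>0"
  proof (cases "topspace T = {}")
    case True
    then show ?thesis unfolding constantly_proportional_def by (intro exI[of _ 1]) simp
  next
    case False
    then obtain p where p: "p \<in> topspace T" by blast
    have "k \<noteq> 0" using k[OF p] rel.support_pos[OF p] aff.support_pos[OF p] by (auto simp: ratio_def)
    moreover have "support \<xi> y p = 1 / k * support \<xi> y\<^sub>0 p" if "p \<in> topspace T" for p
      using k[OF that] rel.support_pos[OF that] aff.support_pos[OF that] by (auto simp: ratio_def)
    ultimately show ?thesis unfolding constantly_proportional_def by (intro exI[of _ "1 / k"]) simp
  qed
qed

end

theorem proposition4p1:
  fixes T :: "'p topology"
    and A :: "('p, 'n::finite) chart set"
    and x \<xi> y y_aff :: "'p \<Rightarrow> real^'m"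
    and r s :: nat
  assumes "CARD('n) \<ge> 2"
    and "r \<ge> 4" and "r > s" and "s \<ge> 1"
    and "hypersurface r T A x \<xi>"
    and "\<forall>p\<in>topspace T. gauss_curvature A x \<xi> p > 0"
    and "positive_definite_II A x \<xi>"
    and "relative_normalization s A x y"
    and "\<forall>p\<in>topspace T. support \<xi> y p > 0"
    and "equiaffine_normalization T A x \<xi> y_aff"
  shows "(\<forall>p\<in>topspace T.
            pick_invariant A x y p / support \<xi> y p
              - pick_invariant A x y_aff p / support \<xi> y_aff p \<ge> 0) \<and>
         ((\<forall>p\<in>topspace T.
            pick_invariant A x y p / support \<xi> y p
              - pick_invariant A x y_aff p / support \<xi> y_aff p = 0)
          \<longleftrightarrow> constantly_proportional T \<xi> y y_aff)"
proof -
  have supp: "support \<xi> y_aff p = gauss_curvature A x \<xi> p powr (1 / (real CARD('n) + 2))" if "p \<in> topspace T" for p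
    using assms(6,10) that by (auto simp: equiaffine_normalization_def)
  interpret affine_comparison T A x \<xi> y y_aff r s 1
  proof unfold_locales
    show "relative_normalization 1 A x y_aff"
      using assms(10) by (simp add: equiaffine_normalization_def)
    show "support \<xi> y_aff p > 0" if "p \<in> topspace T" for p
      using supp[OF that] bspec[OF assms(6) that] by simp
    show "support \<xi> y_aff p ^ (CARD('n) + 2) = gauss_curvature A x \<xi> p" if "p \<in> topspace T" for p
    proof -
      have K: "gauss_curvature A x \<xi> p > 0" using assms(6) that by blast
      have "support \<xi> y_aff p > 0" using K supp[OF that] by simp
      then have "support \<xi> y_aff p ^ (CARD('n) + 2) = support \<xi> y_aff p powr real (CARD('n) + 2)"
        by (rule powr_realpow[symmetric])
      also have "\<dots> = gauss_curvature A x \<xi> p"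
        unfolding supp[OF that] powr_powr using K by (simp add: add.commute add_nonneg_eq_0_iff)
      finally show ?thesis .
    qed
  qed (use assms in auto)
  show ?thesis
  proof (intro conjI ballI pick_difference_nonneg)
    show "(\<forall>p\<in>topspace T. pick_invariant A x y p / support \<xi> y p
              - pick_invariant A x y_aff p / support \<xi> y_aff p = 0)
          \<longleftrightarrow> constantly_proportional T \<xi> y y_aff"
    proof
      assume "\<forall>p\<in>topspace T. pick_invariant A x y p / support \<xi> y p
        - pick_invariant A x y_aff p / support \<xi> y_aff p = 0"
      then have "ratio p' = ratio p" if "p \<in> topspace T" "p' \<in> topspace T" for p p'
        using pick_difference_eq_0_iff that by (intro ratio_constant) blast+
      then show "constantly_proportional T \<xi> y y_aff"
        unfolding proportional_iff by blast
    next
      assume "constantly_proportional T \<xi> y y_aff"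
      then obtain k where "\<And>p. p \<in> topspace T \<Longrightarrow> ratio p = k"
        unfolding proportional_iff by blast
      then show "\<forall>p\<in>topspace T. pick_invariant A x y p / support \<xi> y p
        - pick_invariant A x y_aff p / support \<xi> y_aff p = 0"
        using pick_difference_eq_0_iff ratio_critical by blast
    qed
  qed
qed

end
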